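(* Let $\mathfrak{g}$ be a (finite dimensional, complex) semisimple Lie algebra with a non degenerate symmetric invariant bilinear form $B$ (not necessarily the Killing form), and let $\{\cdot,\cdot\}$ be the associated super Poisson bracket on $\bigwedge\mathfrak{g}$. If $I,I'\in(\bigwedge\mathfrak{g})^{\mathfrak{g}}$, then $\{I,I'\}=0$.
   Context: $\bigwedge\mathfrak{g}=\sum_p\bigwedge^p\mathfrak{g}$ is the algebra of skew symmetric multilinear forms on $\mathfrak{g}$ with the wedge product; $\iota_X\Omega=\Omega(X,\cdot,\dots,\cdot)$ and $\iota_X(1)=0$. $(\bigwedge\mathfrak{g})^{\mathfrak{g}}$ is the space of invariant forms, i.e. those annihilated by $\theta_X(\Omega)(Y_1,\dots,Y_p)=-\sum_i\Omega(Y_1,\dots,[X,Y_i],\dots,Y_p)$ for all $X\in\mathfrak{g}$. The super Poisson bracket is $\{\Omega,\Omega'\}=2(-1)^{w+1}\sum_{j=1}^n\iota_{X_j}(\Omega)\wedge\iota_{X_j}(\Omega')$ for $\Omega\in\bigwedge^w\mathfrak{g}$, $\Omega'\in\bigwedge\mathfrak{g}$, extended bilinearly, where $\{X_1,\dots,X_n\}$ is any orthonormal basis of $\mathfrak{g}$ with respect to $B$. *)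

theory Defs
  imports Complex_Main "HOL-Combinatorics.Permutations"
begin

section \<open>Complex Lie algebras and invariant bilinear forms\<close>

locale complex_lie_algebra = vector_space scale
  for scale :: "complex \<Rightarrow> 'g::ab_group_add \<Rightarrow> 'g" (infixr \<open>*s\<close> 75) +
  fixes br :: "'g \<Rightarrow> 'g \<Rightarrow> 'g"
  assumes linear_br_left: "Vector_Spaces.linear scale scale (\<lambda>x. br x y)"
    and linear_br_right: "Vector_Spaces.linear scale scale (\<lambda>y. br x y)"
    and br_self: "br x x = 0"
    and jacobi: "br x (br y z) + br y (br z x) + br z (br x y) = 0"
begin

definition lie_ideal :: "'g set \<Rightarrow> bool" where
  "lie_ideal I \<longleftrightarrow> subspace I \<and> (\<forall>x. \<forall>y\<in>I. br x y \<in> I)"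

primrec derived_series :: "'g set \<Rightarrow> nat \<Rightarrow> 'g set" where
  "derived_series I 0 = I"
| "derived_series I (Suc k) =
     span {br x y |x y. x \<in> derived_series I k \<and> y \<in> derived_series I k}"

definition solvable :: "'g set \<Rightarrow> bool" where
  "solvable I \<longleftrightarrow> (\<exists>k. derived_series I k = {0})"

text \<open>Equivalently, the radical, i.e. the largest solvable ideal, is zero.\<close>

definition semisimple :: bool where
  "semisimple \<longleftrightarrow> (\<forall>I. lie_ideal I \<and> solvable I \<longrightarrow> I = {0})"

definition nondegenerate_invariant_form :: "('g \<Rightarrow> 'g \<Rightarrow> complex) \<Rightarrow> bool" where
  "nondegenerate_invariant_form B \<longleftrightarrow>
     (\<forall>y. Vector_Spaces.linear scale (*) (\<lambda>x. B x y)) \<and>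
     (\<forall>x. Vector_Spaces.linear scale (*) (\<lambda>y. B x y)) \<and>
     (\<forall>x y. B x y = B y x) \<and>
     (\<forall>x y z. B (br x y) z = B x (br y z)) \<and>
     (\<forall>x. (\<forall>y. B x y = 0) \<longrightarrow> x = 0)"

definition orthonormal_basis :: "('g \<Rightarrow> 'g \<Rightarrow> complex) \<Rightarrow> 'g set \<Rightarrow> bool" where
  "orthonormal_basis B S \<longleftrightarrow>
     finite S \<and> independent S \<and> span S = UNIV \<and>
     (\<forall>x\<in>S. \<forall>y\<in>S. B x y = (if x = y then 1 else 0))"

end


section \<open>The exterior algebra of skew symmetric multilinear forms\<close>

text \<open>
  An element of the exterior algebra is a function on lists of vectors: its
  restriction to the lists of length \<open>p\<close> is its component of degree \<open>p\<close>,
  and the scalars in degree 0 are the values at the empty list.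
\<close>

type_synonym 'g form = "'g list \<Rightarrow> complex"

definition skew_forms :: "(complex \<Rightarrow> 'g::ab_group_add \<Rightarrow> 'g) \<Rightarrow> nat \<Rightarrow> 'g form set" where
  "skew_forms scale p = {\<Omega>.
     (\<forall>vs. length vs \<noteq> p \<longrightarrow> \<Omega> vs = 0) \<and>
     (\<forall>vs i. length vs = p \<and> i < p \<longrightarrow>
        Vector_Spaces.linear scale (*) (\<lambda>x. \<Omega> (vs[i := x]))) \<and>
     (\<forall>vs i j. length vs = p \<and> i < p \<and> j < p \<and> i \<noteq> j \<longrightarrow>
        \<Omega> (vs[i := vs ! j, j := vs ! i]) = - \<Omega> vs)}"

definition component :: "nat \<Rightarrow> 'g form \<Rightarrow> 'g form" where
  "component p \<Omega> = (\<lambda>vs. if length vs = p then \<Omega> vs else 0)"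

definition exterior_algebra :: "(complex \<Rightarrow> 'g::ab_group_add \<Rightarrow> 'g) \<Rightarrow> 'g form set" where
  "exterior_algebra scale = {\<Omega>.
     (\<forall>p. component p \<Omega> \<in> skew_forms scale p) \<and>
     finite {p. component p \<Omega> \<noteq> (\<lambda>_. 0)}}"

text \<open>
  For \<open>\<Omega>\<close> of degree \<open>p\<close> and \<open>\<Omega>'\<close> of degree \<open>q\<close> this is
  the usual wedge product, with the normalisation \<open>1 / (p! q!)\<close> for which
  \<open>contract X\<close> below is a superderivation. The sum over \<open>p\<close> extends it
  bilinearly to inhomogeneous forms.
\<close>

definition wedge :: "'g form \<Rightarrow> 'g form \<Rightarrow> 'g form" where
  "wedge \<Omega> \<Omega>' = (\<lambda>vs. \<Sum>p\<le>length vs.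
     (\<Sum>\<sigma> | \<sigma> permutes {..<length vs}.
        of_int (sign \<sigma>) * \<Omega> (map (\<lambda>i. vs ! \<sigma> i) [0..<p])
                     * \<Omega>' (map (\<lambda>i. vs ! \<sigma> i) [p..<length vs]))
     / (fact p * fact (length vs - p)))"

text \<open>Contraction kills scalars: they vanish on every nonempty list.\<close>

definition contract :: "'g \<Rightarrow> 'g form \<Rightarrow> 'g form" where
  "contract X \<Omega> = (\<lambda>vs. \<Omega> (X # vs))"

definition theta :: "('g \<Rightarrow> 'g \<Rightarrow> 'g) \<Rightarrow> 'g \<Rightarrow> 'g form \<Rightarrow> 'g form" where
  "theta br X \<Omega> = (\<lambda>vs. - (\<Sum>i<length vs. \<Omega> (vs[i := br X (vs ! i)])))"

definition invariant_forms ::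
    "(complex \<Rightarrow> 'g::ab_group_add \<Rightarrow> 'g) \<Rightarrow> ('g \<Rightarrow> 'g \<Rightarrow> 'g) \<Rightarrow> 'g form set" where
  "invariant_forms scale br =
     {\<Omega> \<in> exterior_algebra scale. \<forall>X. theta br X \<Omega> = (\<lambda>_. 0)}"


section \<open>The super Poisson bracket\<close>

text \<open>
  Here \<open>S\<close> is meant to be an orthonormal basis of the Lie algebra; the
  resulting bracket does not depend on which one is used. In
  \<open>poisson_homogeneous S w \<Omega> \<Omega>'\<close> the form \<open>\<Omega>\<close> is of degree \<open>w\<close>.
\<close>

definition poisson_homogeneous :: "'g set \<Rightarrow> nat \<Rightarrow> 'g form \<Rightarrow> 'g form \<Rightarrow> 'g form" where
  "poisson_homogeneous S w \<Omega> \<Omega>' =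
     (\<lambda>vs. 2 * (-1) ^ (w + 1) * (\<Sum>X\<in>S. wedge (contract X \<Omega>) (contract X \<Omega>') vs))"

definition super_poisson :: "'g set \<Rightarrow> 'g form \<Rightarrow> 'g form \<Rightarrow> 'g form" where
  "super_poisson S \<Omega> \<Omega>' =
     (\<lambda>vs. \<Sum>w | component w \<Omega> \<noteq> (\<lambda>_. 0). poisson_homogeneous S w (component w \<Omega>) \<Omega>' vs)"


section \<open>Existence of orthonormal bases\<close>

context complex_lie_algebra
begin

lemma exists_orthonormal_basis:
  assumes fd: "finite_dimensional_vector_space scale E"
    and B: "nondegenerate_invariant_form B"
  shows "\<exists>S. orthonormal_basis B S"
proof -
  interpret fd: finite_dimensional_vector_space scale E by (rule fd)
  have linl: "Vector_Spaces.linear scale (*) (\<lambda>x. B x y)" for y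
    using B by (auto simp: nondegenerate_invariant_form_def)
  have linr: "Vector_Spaces.linear scale (*) (\<lambda>y. B x y)" for x
    using B by (auto simp: nondegenerate_invariant_form_def)
  have sym: "B x y = B y x" for x y
    using B by (auto simp: nondegenerate_invariant_form_def)
  have nondeg: "\<exists>y. B x y \<noteq> 0" if "x \<noteq> 0" for x
    using B that unfolding nondegenerate_invariant_form_def by blast
  note mh = linl[unfolded module_hom_iff_linear[symmetric]]
    linr[unfolded module_hom_iff_linear[symmetric]]
  have addl: "B (x + z) y = B x y + B z y" and addr: "B x (y + z) = B x y + B x z"
    and diffl: "B (x - z) y = B x y - B z y"
    and scl: "B (c *s x) y = c * B x y" and scr: "B x (c *s y) = c * B x y"
    and suml: "B (\<Sum>a\<in>A. f a) y = (\<Sum>a\<in>A. B (f a) y)"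
    and sumr: "B y (\<Sum>a\<in>A. f a) = (\<Sum>a\<in>A. B y (f a))"
    for x y z c and A :: "'g set" and f
    using module_hom.add[OF mh(1)] module_hom.add[OF mh(2)] module_hom.diff[OF mh(1)]
      module_hom.scale[OF mh(1)] module_hom.scale[OF mh(2)] module_hom.sum[OF mh(1)]
      module_hom.sum[OF mh(2)]
    by simp_all
  define ON where "ON S \<longleftrightarrow> finite S \<and> (\<forall>x\<in>S. \<forall>y\<in>S. B x y = (if x = y then 1 else 0))"
    for S :: "'g set"
  have expand: "B (\<Sum>a\<in>S. c a *s a) s = c s" if "ON S" "s \<in> S" for S s c
  proof -
    have "B (\<Sum>a\<in>S. c a *s a) s = (\<Sum>a\<in>S. if a = s then c a else 0)"
      unfolding suml scl using that by (intro sum.cong) (auto simp: ON_def)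
    also have "\<dots> = c s"
      using that by (simp add: ON_def)
    finally show ?thesis .
  qed
  have zero: "B 0 y = 0" for y
    using scl[of 0 0 y] by simp
  have ind: "independent S" if "ON S" for S
  proof (rule independent_if_scalars_zero)
    show "finite S" using that by (simp add: ON_def)
  next
    fix f x assume "(\<Sum>x\<in>S. f x *s x) = 0" "x \<in> S"
    then show "f x = 0" using expand[OF that, of x f] zero by simp
  qed
  have "card S \<le> card E" if "ON S" for S
    using ind[OF that] fd.dim_UNIV fd.independent_card_le_dim[of S UNIV] by simp
  moreover have "ON {}"
    by (simp add: ON_def)
  ultimately obtain S where S: "ON S" and max: "\<And>T. ON T \<Longrightarrow> card T \<le> card S"
    using ex_has_greatest_nat[of ON "{}" card "Suc (card E)"] less_Suc_eq_le by metis
  define pr where "pr v = v - (\<Sum>s\<in>S. B v s *s s)" for v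
  have pr0: "B (pr v) s = 0" if "s \<in> S" for v s
    using expand[OF S that, of "B v"] by (simp add: pr_def diffl)
  have no: "B u u = 0" if u: "\<forall>s\<in>S. B u s = 0" for u
  proof (rule ccontr)
    assume nz: "B u u \<noteq> 0"
    define w where "w = inverse (csqrt (B u u)) *s u"
    have "csqrt (B u u) * csqrt (B u u) = B u u"
      by (metis power2_csqrt power2_eq_square)
    then have ww: "B w w = 1"
      using nz by (simp add: w_def scl scr field_simps)
    have ws: "B w s = 0 \<and> B s w = 0" if "s \<in> S" for s
      using u that sym[of s u] by (simp add: w_def scl scr)
    then have "w \<notin> S"
      using ww by fastforce
    moreover have "ON (insert w S)"
      using S ww ws by (auto simp: ON_def)
    ultimately show False
      using max[of "insert w S"] S by (simp add: ON_def)
  qed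
  have "pr v = 0" for v
  proof (rule ccontr)
    assume "pr v \<noteq> 0"
    then obtain y where y: "B (pr v) y \<noteq> 0"
      using nondeg by blast
    have "B (pr v) (\<Sum>s\<in>S. B y s *s s) = 0"
      using pr0 by (simp add: sumr scr)
    then have "B (pr v) (pr y) = B (pr v) y"
      using addr[of "pr v" "pr y" "\<Sum>s\<in>S. B y s *s s"] by (simp add: pr_def)
    moreover have "B (pr v + pr y) (pr v + pr y) = 0" "B (pr v) (pr v) = 0" "B (pr y) (pr y) = 0"
      using pr0 by (intro no; simp add: addl)+
    ultimately show False
      using y sym[of "pr v" "pr y"] by (simp add: addl addr)
  qed
  then have "v = (\<Sum>s\<in>S. B v s *s s)" for v
    using eq_iff_diff_eq_0 by (simp add: pr_def)
  moreover have "(\<Sum>s\<in>S. B v s *s s) \<in> span S" for v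
    by (intro span_sum span_scale span_base)
  ultimately have "span S = UNIV"
    by (metis UNIV_eq_I)
  then show ?thesis
    using S ind[OF S] by (auto simp: orthonormal_basis_def ON_def)
qed

end

end

theory Submission
  imports Defs "HOL-Computational_Algebra.Fundamental_Theorem_Algebra"
begin

text \<open>
  If \<open>I\<close> is invariant then \<open>d I = 0\<close>, and Cartan's formula gives \<open>d (contract X I) = 0\<close> and, up to sign,
  \<open>contract (br Y Z) I = d (contract Y (contract Z I))\<close>. On a semisimple Lie algebra the Casimir
  operator \<open>C x = (\<Sum>s\<in>S. br s (br s x))\<close> of the adjoint representation is invertible (Cartan's
  criterion), so \<open>X = (\<Sum>s\<in>S. br s (br s (T X)))\<close> with \<open>T = C\<^sup>-\<^sup>1\<close> equivariant, and every
  \<open>contract X I\<close> is \<open>d \<eta>\<^sub>X\<close> with \<open>\<eta>\<^sub>X\<close> equivariant in \<open>X\<close>. Hence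
  \<open>\<Sum>X. contract X I \<and> contract X I' = d (\<Sum>X. \<eta>\<^sub>X \<and> contract X I')\<close> is the differential of an
  invariant form, which is zero. The computation is done directly on alternating sums, without
  introducing \<open>d\<close>.
\<close>

section \<open>Generalized eigenvectors and traces\<close>

locale complex_fd_vector_space = finite_dimensional_vector_space scale Basis
  for scale :: "complex \<Rightarrow> 'g::ab_group_add \<Rightarrow> 'g" (infixr "*s" 75)
    and Basis :: "'g set"
begin

abbreviation endo :: "('g \<Rightarrow> 'g) \<Rightarrow> bool" where
  "endo f \<equiv> Vector_Spaces.linear scale scale f"

lemma endo_simps:
  assumes "endo f"
  shows "f (x + y) = f x + f y" "f (c *s x) = c *s f x" "f 0 = 0" "f (x - y) = f x - f y"
    "f (- x) = - f x" "f (\<Sum>i\<in>A. h i) = (\<Sum>i\<in>A. f (h i))"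
proof -
  interpret module_hom scale scale f
    using assms by (simp add: module_hom_iff_linear)
  show "f (x + y) = f x + f y" "f (c *s x) = c *s f x" "f 0 = 0" "f (x - y) = f x - f y"
    "f (- x) = - f x" "f (\<Sum>i\<in>A. h i) = (\<Sum>i\<in>A. f (h i))"
    by (auto simp: add scale zero diff neg sum)
qed

lemma endoI:
  assumes "\<And>x y. f (x + y) = f x + f y" "\<And>c x. f (c *s x) = c *s f x"
  shows "endo f"
  using assms vector_space_axioms by (simp add: Vector_Spaces.linear_iff)

lemma endo_funpow: "endo f \<Longrightarrow> endo (f ^^ m)"
  by (induction m) (auto intro!: endoI simp: endo_simps)

lemma endo_comp: "endo f \<Longrightarrow> endo g \<Longrightarrow> endo (\<lambda>x. f (g x))"
  by (auto intro!: endoI simp: endo_simps)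

lemma endo_shift: "endo f \<Longrightarrow> endo (\<lambda>v. f v - \<mu> *s v)"
  by (intro endoI) (simp_all add: endo_simps scale_right_distrib scale_right_diff_distrib
      scale_left_commute)

section \<open>Polynomials in an endomorphism and eigenvectors modulo a subspace\<close>

definition poly_apply :: "('g \<Rightarrow> 'g) \<Rightarrow> complex poly \<Rightarrow> 'g \<Rightarrow> 'g" where
  "poly_apply f q v = (\<Sum>i\<le>degree q. coeff q i *s (f ^^ i) v)"

lemma poly_apply_0 [simp]: "poly_apply f 0 v = 0"
  by (simp add: poly_apply_def)

lemma poly_apply_pCons: "poly_apply f (pCons a q) v = a *s v + poly_apply f q (f v)"
proof (cases "q = 0")
  case False
  then have "degree (pCons a q) = Suc (degree q)" by simp
  then show ?thesis
    unfolding poly_apply_def by (simp add: sum.atMost_Suc_shift funpow_swap1 del: sum.atMost_Suc)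
qed (simp add: poly_apply_def)

lemma poly_apply_add: "poly_apply f (p + q) v = poly_apply f p v + poly_apply f q v"
  by (induction p q arbitrary: v rule: poly_induct2)
    (simp_all add: poly_apply_pCons scale_left_distrib algebra_simps)

lemma poly_apply_smult: "poly_apply f (smult c q) v = c *s poly_apply f q v"
  by (induction q arbitrary: v) (simp_all add: poly_apply_pCons scale_right_distrib)

lemma poly_apply_monom: "poly_apply f (monom c n) v = c *s (f ^^ n) v"
  by (induction n arbitrary: v)
    (simp_all add: monom_0 monom_Suc poly_apply_pCons funpow_swap1)

lemma poly_apply_sum: "poly_apply f (\<Sum>i\<in>A. q i) v = (\<Sum>i\<in>A. poly_apply f (q i) v)"
  by (induction A rule: infinite_finite_induct) (simp_all add: poly_apply_add)

lemma poly_apply_linear: "endo f \<Longrightarrow> endo (poly_apply f q)"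
  by (induction q) (auto intro!: endoI simp: poly_apply_pCons endo_simps scale_right_distrib
      scale_left_commute algebra_simps)

text \<open>The first \<open>dim UNIV + 1\<close> iterates of \<open>f\<close> on \<open>v\<close>
  cannot be independent, and a linear relation among them supplies the coefficients of
  \<open>q\<close>. If two iterates coincide, a difference of two monomials is taken
  instead.\<close>

lemma ex_annihilating_poly: "\<exists>q. q \<noteq> 0 \<and> poly_apply f q v = 0"
proof (cases "inj_on (\<lambda>i. (f ^^ i) v) {..dim (UNIV :: 'g set)}")
  case True
  let ?b = "\<lambda>i. (f ^^ i) v" and ?N = "{..dim (UNIV :: 'g set)}"
  have "dependent (?b ` ?N)"
  proof (rule ccontr)
    assume "independent (?b ` ?N)"
    then have "card (?b ` ?N) \<le> dim (UNIV :: 'g set)"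
      using independent_card_le_dim[of "?b ` ?N" UNIV] by simp
    then show False using card_image[OF True] by simp
  qed
  then obtain u where u: "\<exists>w\<in>?b ` ?N. u w \<noteq> 0" "(\<Sum>w\<in>?b ` ?N. u w *s w) = 0"
    by (auto simp: dependent_finite)
  then obtain j where j: "j \<in> ?N" "u (?b j) \<noteq> 0" by auto
  define q where "q = (\<Sum>i\<in>?N. monom (u (?b i)) i)"
  have "coeff q j = u (?b j)"
    using j(1) by (simp add: q_def coeff_sum)
  moreover have "poly_apply f q v = 0"
    using u(2) unfolding sum.reindex[OF True] by (simp add: q_def poly_apply_sum poly_apply_monom)
  ultimately show ?thesis using j(2) by (metis coeff_0)
next
  case False
  then obtain i j where ij: "i \<noteq> j" "(f ^^ i) v = (f ^^ j) v"
    by (auto simp: inj_on_def)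
  define q where "q = monom (1::complex) i + monom (-1) j"
  have "coeff q i \<noteq> 0" using ij(1) by (simp add: q_def)
  moreover have "poly_apply f q v = 0"
    unfolding q_def by (simp add: poly_apply_add poly_apply_monom ij(2))
  ultimately show ?thesis by (metis coeff_0)
qed

text \<open>The linear factors of a polynomial annihilating some \<open>v\<close> outside
  \<open>U\<close> are applied one at a time. The vector just before the first entry into
  \<open>U\<close> is the witness.\<close>

lemma ex_eigenvector_mod_subspace:
  assumes f: "endo f" and U: "subspace U" "U \<noteq> UNIV"
  shows "\<exists>v \<mu>. v \<notin> U \<and> f v - \<mu> *s v \<in> U"
proof -
  obtain v where v: "v \<notin> U" using U by auto
  obtain q where q: "q \<noteq> 0" "poly_apply f q v = 0"
    using ex_annihilating_poly by blast
  have "q \<noteq> 0 \<Longrightarrow> v \<notin> U \<Longrightarrow> poly_apply f q v \<in> U \<Longrightarrow> ?thesis" for q v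
  proof (induction "degree q" arbitrary: q v)
    case 0
    then obtain a where "q = [:a:]" "a \<noteq> 0"
      by (metis degree_eq_zeroE pCons_0_0)
    with 0 have "a *s v \<in> U" by (simp add: poly_apply_pCons)
    then have "(1 / a) *s a *s v \<in> U" by (rule subspace_scale[OF U(1)])
    with \<open>a \<noteq> 0\<close> 0 show ?case by simp
  next
    case (Suc n)
    then have "\<not> constant (poly q)"
      by (metis constant_degree nat.distinct(1))
    then obtain z where "poly q z = 0"
      using fundamental_theorem_of_algebra by blast
    then obtain r where r: "q = [:-z, 1:] * r"
      by (metis poly_eq_0_iff_dvd dvdE)
    with Suc.prems have "r \<noteq> 0" by auto
    then have deg: "n = degree r"
      using Suc.hyps(2) unfolding r by (subst (asm) degree_mult_eq) auto
    have "q = smult (- z) r + pCons 0 r" by (simp add: r)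
    then have "poly_apply f q v = poly_apply f r (f v - z *s v)"
      unfolding endo_simps[OF poly_apply_linear[OF f, of r]]
      by (simp only: poly_apply_add poly_apply_smult poly_apply_pCons) simp
    then show ?case
      using Suc.hyps(1)[OF deg \<open>r \<noteq> 0\<close>, of "f v - z *s v"] Suc.prems by metis
  qed
  then show ?thesis using q v subspace_0[OF U(1)] by metis
qed

section \<open>Generalized eigenspaces and triangular bases\<close>

definition gen_eigenspace :: "('g \<Rightarrow> 'g) \<Rightarrow> complex \<Rightarrow> 'g set" where
  "gen_eigenspace f \<mu> = {v. \<exists>m. ((\<lambda>v. f v - \<mu> *s v) ^^ m) v = 0}"

lemma funpow_eq_0_mono:
  assumes "endo f" "(f ^^ m) v = 0" "m \<le> n"
  shows "(f ^^ n) v = 0"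
proof -
  have "(f ^^ n) v = (f ^^ (n - m)) ((f ^^ m) v)"
    using assms(3) by (metis funpow_add comp_apply le_add_diff_inverse2)
  then show ?thesis using assms endo_simps(3)[OF endo_funpow] by simp
qed

lemma subspace_gen_eigenspace:
  assumes f: "endo f"
  shows "subspace (gen_eigenspace f \<mu>)"
proof (rule subspaceI)
  note N = endo_shift[OF f, of \<mu>]
  note s = endo_simps[OF endo_funpow[OF N]]
  show "0 \<in> gen_eigenspace f \<mu>"
    by (auto simp: gen_eigenspace_def s)
  show "c *s x \<in> gen_eigenspace f \<mu>" if "x \<in> gen_eigenspace f \<mu>" for c x
    using that by (auto simp: gen_eigenspace_def s)
  fix x y assume "x \<in> gen_eigenspace f \<mu>" "y \<in> gen_eigenspace f \<mu>"
  then obtain m n where "((\<lambda>v. f v - \<mu> *s v) ^^ m) x = 0" "((\<lambda>v. f v - \<mu> *s v) ^^ n) y = 0"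
    by (auto simp: gen_eigenspace_def)
  then have "((\<lambda>v. f v - \<mu> *s v) ^^ (max m n)) (x + y) = 0"
    using funpow_eq_0_mono[OF N, of _ _ "max m n"] by (simp add: s)
  then show "x + y \<in> gen_eigenspace f \<mu>"
    by (auto simp: gen_eigenspace_def)
qed

text \<open>Off the eigenvalue \<open>\<mu>\<close> the operator \<open>f - \<nu>\<close> is invertible on \<open>gen_eigenspace f \<mu>\<close>.\<close>

lemma ex_preimage_shift:
  assumes f: "endo f" and U: "subspace U" "\<And>u. u \<in> U \<Longrightarrow> f u \<in> U"
    and u: "u \<in> U" "u \<in> gen_eigenspace f \<mu>" and ne: "\<mu> \<noteq> \<nu>"
  shows "\<exists>w\<in>U. f w - \<nu> *s w = u"
proof -
  obtain m where "((\<lambda>v. f v - \<mu> *s v) ^^ m) u = 0"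
    using u by (auto simp: gen_eigenspace_def)
  then show ?thesis using u(1)
  proof (induction m arbitrary: u)
    case 0
    then show ?case using endo_simps[OF f] by (intro bexI[of _ 0]) auto
  next
    case (Suc m)
    \<comment> \<open>If \<open>f - \<nu>\<close> sends \<open>w\<close> to
      \<open>f u - \<mu> *s u\<close>, it sends \<open>w - u\<close> to
      \<open>(\<nu> - \<mu>) *s u\<close>; it remains to divide by this nonzero scalar.\<close>
    let ?a = "1 / (\<nu> - \<mu>)"
    have "f u - \<mu> *s u \<in> U"
      using Suc.prems U by (auto intro: subspace_diff subspace_scale)
    then obtain w where w: "w \<in> U" "f w - \<nu> *s w = f u - \<mu> *s u"
      using Suc.IH[of "f u - \<mu> *s u"] Suc.prems(1) by (auto simp: funpow_Suc_right simp del: funpow.simps)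
    have "f (w - u) - \<nu> *s (w - u) = (f w - \<nu> *s w) - (f u - \<mu> *s u) + (\<nu> - \<mu>) *s u"
      using endo_simps[OF f] by (simp add: scale_right_diff_distrib scale_left_diff_distrib)
    then have "f (w - u) - \<nu> *s (w - u) = (\<nu> - \<mu>) *s u"
      using w by simp
    then have "f (?a *s (w - u)) - \<nu> *s (?a *s (w - u)) = u"
      using ne unfolding endo_simps(2)[OF f] scale_left_commute[of \<nu>]
        scale_right_diff_distrib[symmetric] by simp
    then show ?case
      using w Suc.prems U by (intro bexI[of _ "?a *s (w - u)"]) (auto intro: subspace_diff subspace_scale)
  qed
qed

text \<open>The head is the vector added last, and for linear \<open>f\<close> every suffix spans an
  invariant subspace. Membership in a generalized eigenspace adapts the basis to the primary
  decomposition of \<open>f\<close> as well.\<close>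

primrec triangular :: "('g \<Rightarrow> 'g) \<Rightarrow> ('g \<Rightarrow> complex) \<Rightarrow> 'g list \<Rightarrow> bool" where
  "triangular f lam [] \<longleftrightarrow> True"
| "triangular f lam (p # ps) \<longleftrightarrow> p \<notin> span (set ps) \<and> f p - lam p *s p \<in> span (set ps) \<and>
     p \<in> gen_eigenspace f (lam p) \<and> triangular f lam ps"

lemma triangular_independent:
  "triangular f lam ps \<Longrightarrow> independent (set ps) \<and> distinct ps"
  by (induction ps) (auto simp: independent_insert independent_empty intro: span_base)

lemma triangular_cong:
  "(\<And>p. p \<in> set ps \<Longrightarrow> lam p = lam' p) \<Longrightarrow> triangular f lam ps = triangular f lam' ps"
  by (induction ps) auto

lemma triangular_gen_eigenspace:
  "triangular f lam ps \<Longrightarrow> p \<in> set ps \<Longrightarrow> p \<in> gen_eigenspace f (lam p)"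
  by (induction ps) auto

lemma endo_span_subset:
  assumes f: "endo f" and "subspace U" "\<And>p. p \<in> P \<Longrightarrow> f p \<in> U" "u \<in> span P"
  shows "f u \<in> U"
  using assms(4)
proof (induction rule: span_induct_alt)
  case base
  then show ?case using assms(2) by (simp add: endo_simps[OF f] subspace_0)
next
  case (step c x y)
  then show ?case using assms by (simp add: endo_simps[OF f] subspace_add subspace_scale)
qed

lemma triangular_invariant:
  assumes f: "endo f" and "triangular f lam ps" "u \<in> span (set ps)"
  shows "f u \<in> span (set ps)"
proof -
  have "f p \<in> span (set ps)" if "p \<in> set ps" for p
    using assms(2) that
  proof (induction ps)
    case (Cons q ps)
    have sub: "span (set ps) \<subseteq> span (set (q # ps))"
      by (intro span_mono) auto
    show ?case
    proof (cases "p = q")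
      case True
      have "(f p - lam p *s p) + lam p *s p \<in> span (set (q # ps))"
        using Cons.prems sub True by (intro span_add span_scale) (auto intro: span_base)
      then show ?thesis by simp
    next
      case False
      then show ?thesis using Cons sub by auto
    qed
  qed simp
  then show ?thesis
    using endo_span_subset[OF f subspace_span] assms(3) by blast
qed

text \<open>An eigenvector \<open>v\<close> modulo the span is corrected by some \<open>w\<close> in
  the span, so that \<open>v - w\<close> is a generalized eigenvector for the same
  \<open>\<mu>\<close>.\<close>

lemma triangular_extend:
  assumes f: "endo f" and T: "triangular f lam ps" and ne: "span (set ps) \<noteq> UNIV"
  shows "\<exists>p lam'. triangular f lam' (p # ps)"
proof -
  let ?U = "span (set ps)"
  obtain v \<mu> where v: "v \<notin> ?U" "f v - \<mu> *s v \<in> ?U"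
    using ex_eigenvector_mod_subspace[OF f subspace_span ne] by blast
  note inv = triangular_invariant[OF f T]
  let ?G = "gen_eigenspace f \<mu>"
  note G = subspace_gen_eigenspace[OF f, of \<mu>]
  \<comment> \<open>Up to elements of \<open>?G\<close>, the span is its own image under
    \<open>f - \<mu>\<close>: basis vectors with eigenvalue \<open>\<mu>\<close> lie in
    \<open>?G\<close>, and the others have a preimage.\<close>
  have "\<exists>w\<in>?U. u - (f w - \<mu> *s w) \<in> ?G" if "u \<in> ?U" for u
    using that
  proof (induction rule: span_induct_alt)
    case base
    show ?case
      using endo_simps[OF f] subspace_0[OF G] by (intro bexI[of _ 0]) (auto intro: span_zero)
  next
    case (step c x y)
    have "\<exists>w\<in>?U. x - (f w - \<mu> *s w) \<in> ?G"
    proof (cases "lam x = \<mu>")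
      case True
      then show ?thesis using triangular_gen_eigenspace[OF T step(1)] endo_simps[OF f]
        by (intro bexI[of _ 0]) (auto intro: span_zero)
    next
      case False
      then obtain w where "w \<in> ?U" "f w - \<mu> *s w = x"
        using ex_preimage_shift[OF f subspace_span[of "set ps"] inv span_base[OF step(1)]
            triangular_gen_eigenspace[OF T step(1)] False] by blast
      then show ?thesis using subspace_0[OF G] by (intro bexI[of _ w]) auto
    qed
    then obtain w w' where w: "w \<in> ?U" "x - (f w - \<mu> *s w) \<in> ?G"
      "w' \<in> ?U" "y - (f w' - \<mu> *s w') \<in> ?G"
      using step by blast
    have "(c *s x + y) - (f (c *s w + w') - \<mu> *s (c *s w + w')) =
        c *s (x - (f w - \<mu> *s w)) + (y - (f w' - \<mu> *s w'))"
      by (simp add: endo_simps[OF f] scale_right_distrib scale_right_diff_distrib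
          scale_left_commute[of \<mu>])
    also have "\<dots> \<in> ?G"
      using w G by (intro subspace_add subspace_scale)
    finally show ?case using w by (intro bexI[of _ "c *s w + w'"]) (auto intro: span_add span_scale)
  qed
  then obtain w where w: "w \<in> ?U" "(f v - \<mu> *s v) - (f w - \<mu> *s w) \<in> ?G"
    using v(2) by blast
  define p where "p = v - w"
  have fp: "f p - \<mu> *s p = (f v - \<mu> *s v) - (f w - \<mu> *s w)"
    by (simp add: p_def endo_simps[OF f] scale_right_diff_distrib)
  obtain m where "((\<lambda>v. f v - \<mu> *s v) ^^ m) (f p - \<mu> *s p) = 0"
    using w(2) unfolding fp[symmetric] by (auto simp: gen_eigenspace_def)
  then have "((\<lambda>v. f v - \<mu> *s v) ^^ Suc m) p = 0"
    by (simp add: funpow_Suc_right del: funpow.simps)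
  then have pG: "p \<in> ?G"
    unfolding gen_eigenspace_def by blast
  have pU: "p \<notin> ?U"
    using v(1) w(1) unfolding p_def by (metis diff_add_cancel span_add)
  have fpU: "f p - \<mu> *s p \<in> ?U"
    unfolding fp using v w inv by (auto intro!: span_diff span_scale)
  have "p \<notin> set ps" using pU by (auto intro: span_base)
  then have "triangular f (lam(p := \<mu>)) ps"
    using T by (subst triangular_cong[where lam' = lam]) auto
  then have "triangular f (lam(p := \<mu>)) (p # ps)"
    using pG pU fpU by simp
  then show ?thesis by blast
qed

text \<open>Triangular lists are independent, so extending \<open>dim UNIV + 1\<close> times is
  impossible unless a spanning list is met.\<close>

lemma ex_triangular_basis:
  assumes f: "endo f"
  shows "\<exists>lam ps. triangular f lam ps \<and> span (set ps) = UNIV"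
proof -
  have "\<exists>lam ps. triangular f lam ps \<and> (length ps = k \<or> span (set ps) = UNIV)" for k
  proof (induction k)
    case 0
    show ?case by (intro exI[of _ "\<lambda>_. 0"] exI[of _ "[]"]) simp
  next
    case (Suc k)
    then obtain lam ps where *: "triangular f lam ps" "length ps = k \<or> span (set ps) = UNIV"
      by blast
    show ?case
    proof (cases "span (set ps) = UNIV")
      case False
      then obtain p lam' where "triangular f lam' (p # ps)"
        using triangular_extend[OF f *(1)] by blast
      then show ?thesis using * False by (intro exI[of _ lam'] exI[of _ "p # ps"]) auto
    qed (use * in blast)
  qed
  from this[of "Suc (dim (UNIV :: 'g set))"] obtain lam ps where
    *: "triangular f lam ps" "length ps = Suc (dim (UNIV :: 'g set)) \<or> span (set ps) = UNIV"
    by blast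
  have "length ps \<le> dim (UNIV :: 'g set)"
    using triangular_independent[OF *(1)] independent_card_le_dim[of "set ps" UNIV]
    by (simp add: distinct_card)
  then show ?thesis using * by auto
qed

text \<open>The semisimple part of \<open>f\<close> with its eigenvalues conjugated.\<close>

definition conj_part :: "('g \<Rightarrow> complex) \<Rightarrow> 'g set \<Rightarrow> 'g \<Rightarrow> 'g" where
  "conj_part lam T v = (\<Sum>t\<in>T. (representation T v t * cnj (lam t)) *s t)"

lemma endo_conj_part:
  assumes "independent T" "span T = UNIV"
  shows "endo (conj_part lam T)"
  by (intro endoI)
    (simp_all add: assms conj_part_def representation_add representation_scale sum.distrib
      scale_left_distrib ring_distribs scale_sum_right ac_simps)

lemma conj_part_basis:
  assumes "finite T" "independent T" "t \<in> T"
  shows "conj_part lam T t = cnj (lam t) *s t"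
proof -
  have "conj_part lam T t = (\<Sum>s\<in>T. if s = t then cnj (lam t) *s t else 0)"
    unfolding conj_part_def representation_basis[OF assms(2,3)]
    by (intro sum.cong) auto
  then show ?thesis using assms by simp
qed

text \<open>The operator thus depends on the generalized eigenspaces of \<open>f\<close> only, not
  on the basis, which later makes it compatible with brackets. The induction strips the head
  \<open>q\<close>, which can occur in \<open>v\<close> only if
  \<open>lam q = \<mu>\<close>.\<close>

lemma conj_part_gen_eigenspace:
  assumes f: "endo f" and T: "triangular f lam ps" "span (set ps) = UNIV"
    and v: "v \<in> gen_eigenspace f \<mu>"
  shows "conj_part lam (set ps) v = cnj \<mu> *s v"
proof -
  note ind = triangular_independent[OF T(1)]
  let ?c = "conj_part lam (set ps)"
  have c: "endo ?c" using endo_conj_part ind T(2) by blast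
  have cb: "?c p = cnj (lam p) *s p" if "p \<in> set ps" for p
    using conj_part_basis[of "set ps" p lam] ind that by simp
  have "?c v = cnj \<mu> *s v"
    if "triangular f lam qs" "set qs \<subseteq> set ps" "v \<in> span (set qs)" "v \<in> gen_eigenspace f \<mu>" for qs v
    using that
  proof (induction qs arbitrary: v)
    case Nil
    then show ?case by (simp add: endo_simps[OF c])
  next
    case (Cons q qs)
    let ?U = "span (set qs)"
    obtain a where a: "v - a *s q \<in> ?U"
      using Cons.prems(3) span_breakdown_eq[of v q "set qs"] by auto
    show ?case
    proof (cases "a = 0")
      case True
      then show ?thesis using Cons a by simp
    next
      case False
      let ?N = "\<lambda>v. f v - \<mu> *s v"
      note N = endo_simps[OF endo_shift[OF f, of \<mu>]]
      have inv: "?N u \<in> ?U" if "u \<in> ?U" for u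
        using triangular_invariant[OF f _ that] Cons.prems that by (auto intro: span_diff span_scale)
      have q: "f q - lam q *s q \<in> ?U" "q \<notin> ?U" using Cons.prems by auto
      \<comment> \<open>Modulo the span of the tail, \<open>?N\<close> multiplies \<open>q\<close>
        by \<open>lam q - \<mu>\<close>. Since some iterate kills \<open>v\<close> and
        \<open>a\<close> is nonzero, this factor must vanish.\<close>
      have pow: "(?N ^^ m) v - ((lam q - \<mu>) ^ m * a) *s q \<in> ?U" for m
      proof (induction m)
        case 0
        then show ?case using a by simp
      next
        case (Suc m)
        let ?x = "(?N ^^ m) v" and ?b = "(lam q - \<mu>) ^ m * a"
        have "?N (?x - ?b *s q) + ?b *s (f q - lam q *s q) \<in> ?U"
          using inv[OF Suc] q by (auto intro: span_add span_scale)
        also have "?N (?x - ?b *s q) + ?b *s (f q - lam q *s q) =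
            ?N ?x - ((lam q - \<mu>) * ?b) *s q"
          by (simp add: endo_simps[OF f] scale_right_diff_distrib scale_left_diff_distrib
              algebra_simps)
        finally show ?case by (simp add: ac_simps)
      qed
      obtain m where "(?N ^^ m) v = 0"
        using Cons.prems by (auto simp: gen_eigenspace_def)
      with pow[of m] have "- (((lam q - \<mu>) ^ m * a) *s q) \<in> ?U" by simp
      then have "((lam q - \<mu>) ^ m * a) *s q \<in> ?U" using span_neg by fastforce
      then have "(lam q - \<mu>) ^ m * a = 0"
        using q(2) by (metis scale_scale scale_one span_scale left_inverse)
      with False have lam: "lam q = \<mu>" by auto
      have G: "v - a *s q \<in> gen_eigenspace f \<mu>"
        using Cons.prems lam subspace_gen_eigenspace[OF f] by (auto intro!: subspace_diff subspace_scale)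
      have "?c (v - a *s q) = cnj \<mu> *s (v - a *s q)"
        using Cons a G by auto
      moreover have "?c q = cnj \<mu> *s q" using cb[of q] lam Cons.prems by simp
      ultimately show ?thesis
        by (simp add: endo_simps[OF c] scale_right_diff_distrib mult.commute)
    qed
  qed
  then show ?thesis using T v by auto
qed

section \<open>Traces relative to a basis\<close>

definition trace :: "'g set \<Rightarrow> ('g \<Rightarrow> 'g) \<Rightarrow> complex" where
  "trace T f = (\<Sum>t\<in>T. representation T (f t) t)"

context
  fixes T :: "'g set"
  assumes T: "finite T" "independent T" "span T = UNIV"
begin

lemma representation_linear:
  "representation T (x + y) t = representation T x t + representation T y t"
  "representation T (x - y) t = representation T x t - representation T y t"
  "representation T (c *s x) t = c * representation T x t"
  "representation T (\<Sum>i\<in>A. h i) t = (\<Sum>i\<in>A. representation T (h i) t)"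
  using T by (simp_all add: representation_add representation_diff representation_scale
      representation_sum)

lemma representation_expand: "(\<Sum>t\<in>T. representation T v t *s t) = v"
  by (rule sum_representation_eq) (use T in auto)

lemma trace_diff: "trace T (\<lambda>x. f x - g x) = trace T f - trace T g"
  by (simp add: trace_def representation_linear sum_subtractf)

lemma trace_comp:
  assumes "endo f" "endo g"
  shows "trace T (\<lambda>x. f (g x)) = (\<Sum>s\<in>T. \<Sum>t\<in>T. representation T (g s) t * representation T (f t) s)"
proof -
  have "f (g s) = (\<Sum>t\<in>T. representation T (g s) t *s f t)" for s
    by (subst representation_expand[of "g s", symmetric]) (simp only: endo_simps[OF assms(1)])
  then show ?thesis by (simp add: trace_def representation_linear)
qed

lemma trace_commute:
  assumes "endo f" "endo g"
  shows "trace T (\<lambda>x. f (g x)) = trace T (\<lambda>x. g (f x))"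
  unfolding trace_comp[OF assms] trace_comp[OF assms(2,1)]
  by (subst sum.swap) (simp add: mult.commute)

end

text \<open>This links traces over the orthonormal basis, which compute the Killing form, to traces
  over a triangular basis. Expanding in both bases gives the same double sum.\<close>

lemma trace_basis_independent:
  assumes f: "endo f" and S: "finite S" "independent S" "span S = UNIV"
    and T: "finite T" "independent T" "span T = UNIV"
  shows "trace S f = trace T f"
proof -
  have "representation T (f t) t = (\<Sum>s\<in>S. representation S (f t) s * representation T s t)" for t
    by (subst (1) representation_expand[OF S, of "f t", symmetric])
      (simp only: representation_linear[OF T])
  then have "trace T f = (\<Sum>t\<in>T. \<Sum>s\<in>S. representation S (f t) s * representation T s t)"
    by (simp add: trace_def)
  also have "\<dots> = (\<Sum>s\<in>S. \<Sum>t\<in>T. representation T s t * representation S (f t) s)"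
    by (subst sum.swap) (simp add: mult.commute)
  also have "\<dots> = (\<Sum>s\<in>S. representation S (f s) s)"
  proof (rule sum.cong)
    fix s
    have "f s = (\<Sum>t\<in>T. representation T s t *s f t)"
      by (subst (1) representation_expand[OF T, of s, symmetric]) (simp only: endo_simps[OF f])
    then show "(\<Sum>t\<in>T. representation T s t * representation S (f t) s) = representation S (f s) s"
      by (simp add: representation_linear[OF S])
  qed simp
  finally show ?thesis by (simp add: trace_def)
qed

text \<open>In the triangular basis \<open>f\<close> has diagonal entries \<open>lam p\<close>, and
  \<open>conj_part\<close> is diagonal with the conjugate entries.\<close>

lemma trace_conj_part:
  assumes f: "endo f" and T: "triangular f lam ps" "span (set ps) = UNIV"
  shows "trace (set ps) (\<lambda>x. f (conj_part lam (set ps) x)) = (\<Sum>p\<in>set ps. of_real ((cmod (lam p))\<^sup>2))"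
  unfolding trace_def
proof (rule sum.cong)
  fix p assume p: "p \<in> set ps"
  note ind = triangular_independent[OF T(1)]
  have B: "finite (set ps)" "independent (set ps)" "span (set ps) = UNIV"
    using ind T by auto
  note r = representation_linear[OF B]
  have "representation (set ps) (f p) p = lam p"
    using p T(1) ind
  proof -
    \<comment> \<open>Cutting the list at \<open>p\<close> places \<open>f p - lam p *s p\<close> in
      the span of the vectors after \<open>p\<close>, where the \<open>p\<close>-coordinate is
      zero.\<close>
    obtain xs ys where xy: "ps = xs @ p # ys" using p by (meson split_list)
    have "triangular f lam (p # ys)"
      using T(1) unfolding xy by (induction xs) auto
    then have "f p - lam p *s p \<in> span (set ys)" by simp
    moreover have "p \<notin> set ys" "set ys \<subseteq> set ps"
      using ind xy by auto
    moreover have "representation (set ps) u p = 0" if "u \<in> span Y" "p \<notin> Y" "Y \<subseteq> set ps" for u Y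
      using that representation_extend[OF B(2) that(1,3)] representation_ne_zero by metis
    ultimately have "representation (set ps) (f p - lam p *s p) p = 0" by blast
    then show ?thesis using p B by (simp add: r representation_basis)
  qed
  moreover have "f (conj_part lam (set ps) p) = cnj (lam p) *s f p"
    using conj_part_basis[OF B(1,2) p] by (simp add: endo_simps[OF f])
  ultimately show "representation (set ps) (f (conj_part lam (set ps) p)) p = of_real ((cmod (lam p))\<^sup>2)"
    by (simp add: r mult.commute flip: complex_norm_square)
qed simp

text \<open>A vanishing sum of squared moduli makes every eigenvalue zero, so the generalized
  eigenspace of \<open>0\<close> is the whole space.\<close>

lemma trace_conj_part_eq_0:
  assumes f: "endo f" and T: "triangular f lam ps" "span (set ps) = UNIV"
    and tr: "trace (set ps) (\<lambda>x. f (conj_part lam (set ps) x)) = 0"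
  shows "\<exists>m. (f ^^ m) v = 0"
proof -
  have "(\<Sum>p\<in>set ps. (cmod (lam p))\<^sup>2) = 0"
    using tr unfolding trace_conj_part[OF f T] of_real_sum[symmetric] of_real_eq_0_iff .
  then have 0: "lam p = 0" if "p \<in> set ps" for p
    using that by (subst (asm) sum_nonneg_eq_0_iff) auto
  have "set ps \<subseteq> gen_eigenspace f 0"
    using triangular_gen_eigenspace[OF T(1)] 0 by (metis subsetI)
  then have "span (set ps) \<subseteq> gen_eigenspace f 0"
    using span_minimal subspace_gen_eigenspace[OF f] by blast
  then show ?thesis using T(2) by (auto simp: gen_eigenspace_def)
qed

end

section \<open>Invertibility of the Casimir operator\<close>

locale fd_complex_lie_algebra =
  complex_lie_algebra scale br + complex_fd_vector_space scale Basis
  for scale :: "complex \<Rightarrow> 'g::ab_group_add \<Rightarrow> 'g" (infixr "*s" 75)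
    and br :: "'g \<Rightarrow> 'g \<Rightarrow> 'g" and Basis :: "'g set"
begin

section \<open>The adjoint representation and Engel's theorem\<close>

lemmas br_simps = endo_simps[OF linear_br_left] endo_simps[OF linear_br_right]

lemma br_skew: "br x y = - br y x"
proof -
  have "br (x + y) (x + y) = br x y + br y x"
    unfolding br_simps by (simp add: br_self)
  then show ?thesis by (simp add: br_self eq_neg_iff_add_eq_0)
qed

lemma br_derivation: "br x (br y z) = br (br x y) z + br y (br x z)"
proof -
  have "br y (br z x) = - br y (br x z)" "br z (br x y) = - br (br x y) z"
    using br_skew[of z x] br_skew[of z "br x y"] by (simp_all add: br_simps)
  then show ?thesis using jacobi[of x y z] by (simp add: algebra_simps)
qed

lemma br_br_left: "br (br y z) u = br y (br z u) - br z (br y u)"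
  using br_derivation[of y z u] by simp

text \<open>By the Leibniz rule, \<open>br x - (\<mu> + \<nu>)\<close> sends \<open>br v w\<close>
  to \<open>br ?v w + br v ?w\<close>, and each summand lowers one of the two exponents. The
  induction is on their sum.\<close>

lemma br_gen_eigenspace:
  assumes "v \<in> gen_eigenspace (br x) \<mu>" "w \<in> gen_eigenspace (br x) \<nu>"
  shows "br v w \<in> gen_eigenspace (br x) (\<mu> + \<nu>)"
proof -
  let ?G = "gen_eigenspace (br x) (\<mu> + \<nu>)"
  note G = subspace_gen_eigenspace[OF linear_br_right, of x "\<mu> + \<nu>"]
  have "((\<lambda>v. br x v - \<mu> *s v) ^^ m) v = 0 \<Longrightarrow> ((\<lambda>v. br x v - \<nu> *s v) ^^ n) w = 0 \<Longrightarrow> br v w \<in> ?G"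
    for m n v w
  proof (induction "m + n" arbitrary: m n v w)
    case 0
    then show ?case using subspace_0[OF G] by (simp add: br_simps)
  next
    case (Suc k)
    show ?case
    proof (cases "m = 0 \<or> n = 0")
      case True
      then show ?thesis using Suc.prems subspace_0[OF G] by (auto simp: br_simps)
    next
      case False
      then obtain m' n' where mn: "m = Suc m'" "n = Suc n'"
        by (metis not0_implies_Suc)
      let ?v = "br x v - \<mu> *s v" and ?w = "br x w - \<nu> *s w"
      have "br ?v w \<in> ?G"
        using Suc.hyps(1)[of m' n ?v w] Suc.hyps(2) Suc.prems
        by (simp add: mn funpow_Suc_right del: funpow.simps)
      moreover have "br v ?w \<in> ?G"
        using Suc.hyps(1)[of m n' v ?w] Suc.hyps(2) Suc.prems
        by (simp add: mn funpow_Suc_right del: funpow.simps)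
      ultimately have "br ?v w + br v ?w \<in> ?G"
        by (rule subspace_add[OF G])
      also have "br ?v w + br v ?w = br x (br v w) - (\<mu> + \<nu>) *s br v w"
        by (simp add: br_simps br_derivation[of x v w] scale_left_distrib)
      finally obtain j where
        "((\<lambda>v. br x v - (\<mu> + \<nu>) *s v) ^^ j) (br x (br v w) - (\<mu> + \<nu>) *s br v w) = 0"
        by (auto simp: gen_eigenspace_def)
      then have "((\<lambda>v. br x v - (\<mu> + \<nu>) *s v) ^^ Suc j) (br v w) = 0"
        by (simp add: funpow_Suc_right del: funpow.simps)
      then show ?thesis
        unfolding gen_eigenspace_def by blast
    qed
  qed
  then show ?thesis using assms by (auto simp: gen_eigenspace_def)
qed

text \<open>Eigenvalues add under the bracket of generalized eigenvectors, and conjugation is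
  additive; bilinearity extends the rule from the basis.\<close>

lemma conj_part_derivation:
  assumes T: "triangular (br x) lam ps" "span (set ps) = UNIV"
  shows "conj_part lam (set ps) (br y z) = br (conj_part lam (set ps) y) z + br y (conj_part lam (set ps) z)"
proof -
  note ind = triangular_independent[OF T(1)]
  let ?c = "conj_part lam (set ps)"
  have c: "endo ?c" using endo_conj_part ind T(2) by blast
  note s = endo_simps[OF c]
  have eig: "?c v = cnj \<mu> *s v" if "v \<in> gen_eigenspace (br x) \<mu>" for v \<mu>
    using conj_part_gen_eigenspace[OF linear_br_right T that] .
  have pq: "?c (br p q) = br (?c p) q + br p (?c q)" if "p \<in> set ps" "q \<in> set ps" for p q
    using eig[OF br_gen_eigenspace[OF triangular_gen_eigenspace[OF T(1) that(1)]
          triangular_gen_eigenspace[OF T(1) that(2)]]]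
      eig[OF triangular_gen_eigenspace[OF T(1) that(1)]]
      eig[OF triangular_gen_eigenspace[OF T(1) that(2)]]
    by (simp add: br_simps scale_left_distrib)
  have p: "?c (br p z) = br (?c p) z + br p (?c z)" if "p \<in> set ps" for p z
  proof -
    have "z \<in> span (set ps)" using T(2) by simp
    then show ?thesis
      by (induction rule: span_induct_alt)
        (simp_all add: br_simps s pq[OF that] scale_right_distrib algebra_simps)
  qed
  have "y \<in> span (set ps)" using T(2) by simp
  then show ?thesis
    by (induction rule: span_induct_alt)
      (simp_all add: br_simps s p scale_right_distrib algebra_simps)
qed

text \<open>Engel's theorem, stated for the subquotient \<open>W / U\<close> of the adjoint representation so that
  the induction can be applied both to \<open>L / K\<close> and to \<open>W / U\<close> for a maximal proper subalgebra \<open>K\<close>.\<close>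

lemma engel:
  assumes "subspace L" "\<And>x y. x \<in> L \<Longrightarrow> y \<in> L \<Longrightarrow> br x y \<in> L"
    and "\<And>x v. x \<in> L \<Longrightarrow> \<exists>m. (br x ^^ m) v = 0"
    and "subspace U" "subspace W" "U \<subset> W"
    and "\<And>x u. x \<in> L \<Longrightarrow> u \<in> U \<Longrightarrow> br x u \<in> U" "\<And>x w. x \<in> L \<Longrightarrow> w \<in> W \<Longrightarrow> br x w \<in> W"
  shows "\<exists>w\<in>W - U. \<forall>x\<in>L. br x w \<in> U"
  using assms
proof (induction "dim L" arbitrary: L U W rule: less_induct)
  case less
  note L = less.prems(1,2) and nil = less.prems(3) and U = less.prems(4,7) and W = less.prems(5,8)
  show ?case
  proof (cases "L = {0}")
    case True
    then show ?thesis
      using \<open>U \<subset> W\<close> subspace_0[OF U(1)] by (auto simp: br_simps)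
  next
    case False
    \<comment> \<open>\<open>P\<close> singles out the proper subalgebras of \<open>L\<close>;
      \<open>K\<close> is one of largest dimension.\<close>
    define P where "P K \<longleftrightarrow> subspace K \<and> (\<forall>x\<in>K. \<forall>y\<in>K. br x y \<in> K) \<and> K \<subset> L" for K
    have "P {0}"
      using False subspace_0[OF L(1)] by (auto simp: P_def br_simps)
    moreover have "dim K \<le> dim (UNIV :: 'g set)" for K
      by (rule dim_subset) simp
    ultimately obtain K where K: "P K" and max: "\<And>K'. P K' \<Longrightarrow> dim K' \<le> dim K"
      using ex_has_greatest_nat[of P "{0}" dim "Suc (dim (UNIV :: 'g set))"] less_Suc_eq_le by metis
    have sub: "dim X < dim Y" if "subspace X" "subspace Y" "X \<subset> Y" for X Y
      using that by (intro dim_psubset) (simp add: span_eq_iff[THEN iffD2])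
    have dimK: "dim K < dim L"
      using K L by (auto simp: P_def intro: sub)
    have KL: "k \<in> L" if "k \<in> K" for k
      using K that by (auto simp: P_def)
    \<comment> \<open>The induction hypothesis for \<open>K\<close> acting on \<open>L / K\<close>
      yields \<open>x\<close> outside \<open>K\<close> that normalizes \<open>K\<close>.\<close>
    have "\<exists>x\<in>L - K. \<forall>k\<in>K. br k x \<in> K"
      using K L by (intro less.hyps[OF dimK]) (auto simp: P_def intro: nil)
    then obtain x where x: "x \<in> L" "x \<notin> K" "\<And>k. k \<in> K \<Longrightarrow> br k x \<in> K"
      by auto
    have spK: "span K = K" using K by (simp add: P_def span_eq_iff)
    \<comment> \<open>\<open>K\<close> together with \<open>x\<close> spans a larger subalgebra,
      which by maximality is all of \<open>L\<close>.\<close>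
    have "\<not> P (span (insert x K))"
    proof
      assume "P (span (insert x K))"
      moreover have "K \<subset> span (insert x K)"
        using x(2) span_superset[of "insert x K"] by auto
      ultimately have "dim K < dim (span (insert x K))"
        using K by (intro sub) (auto simp: P_def)
      then show False using max[OF \<open>P (span (insert x K))\<close>] by simp
    qed
    moreover have "br a b \<in> span (insert x K)" if "a \<in> span (insert x K)" "b \<in> span (insert x K)" for a b
    proof -
      obtain c d where cd: "a - c *s x \<in> K" "b - d *s x \<in> K"
        using \<open>a \<in> span (insert x K)\<close> \<open>b \<in> span (insert x K)\<close> by (auto simp: span_breakdown_eq spK)
      define k l where "k = a - c *s x" and "l = b - d *s x"
      have "br a b = br (k + c *s x) (l + d *s x)" by (simp add: k_def l_def)
      also have "\<dots> = br k l + d *s br k x - c *s br l x"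
        using br_skew[of x l] by (simp add: br_simps br_self)
      also have "\<dots> \<in> K"
        using cd x(3) K unfolding k_def[symmetric] l_def[symmetric]
        by (intro subspace_add subspace_diff subspace_scale) (auto simp: P_def)
      finally show ?thesis by (intro span_base) auto
    qed
    moreover have "span (insert x K) \<subseteq> L"
      using x(1) KL L(1) by (intro span_minimal) auto
    ultimately have spL: "span (insert x K) = L"
      unfolding P_def by auto
    \<comment> \<open>The induction hypothesis again, now for \<open>K\<close> acting on
      \<open>W / U\<close>.\<close>
    have "\<exists>w\<in>W - U. \<forall>k\<in>K. br k w \<in> U"
      using K less.prems KL by (intro less.hyps[OF dimK]) (auto simp: P_def)
    then obtain w where w: "w \<in> W" "w \<notin> U" "\<And>k. k \<in> K \<Longrightarrow> br k w \<in> U"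
      by auto
    \<comment> \<open>Being killed by \<open>K\<close> modulo \<open>U\<close> is preserved by
      \<open>br x\<close>, because \<open>br k x\<close> stays in \<open>K\<close>.\<close>
    have pow: "(br x ^^ j) w \<in> W \<and> (\<forall>k\<in>K. br k ((br x ^^ j) w) \<in> U)" for j
    proof (induction j)
      case 0
      then show ?case using w by simp
    next
      case (Suc j)
      then show ?case
        using W(2)[OF x(1)] U(2)[OF x(1)] x(3) subspace_add[OF U(1)]
        by (simp add: br_derivation[of _ x])
    qed
    \<comment> \<open>The iterate just before the first entry into \<open>U\<close> is killed modulo
      \<open>U\<close> by \<open>x\<close> as well as by \<open>K\<close>, hence by
      \<open>L\<close>.\<close>
    define m where "m = (LEAST m. (br x ^^ m) w \<in> U)"
    obtain m0 where "(br x ^^ m0) w = 0" using nil[OF x(1)] by blast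
    then have "(br x ^^ m0) w \<in> U" using subspace_0[OF U(1)] by simp
    then have m: "(br x ^^ m) w \<in> U" unfolding m_def by (rule LeastI)
    then obtain j where j: "m = Suc j"
      using w(2) by (cases m) auto
    then have nU: "(br x ^^ j) w \<notin> U"
      using not_less_Least[of j "\<lambda>m. (br x ^^ m) w \<in> U"] unfolding m_def[symmetric] by simp
    have "br y ((br x ^^ j) w) \<in> U" if "y \<in> L" for y
    proof -
      obtain c where "y - c *s x \<in> K"
        using \<open>y \<in> L\<close> unfolding spL[symmetric] span_breakdown_eq spK by blast
      then have "br (y - c *s x) ((br x ^^ j) w) + c *s br x ((br x ^^ j) w) \<in> U"
        using pow[of j] m j by (intro subspace_add subspace_scale U(1)) auto
      then show ?thesis by (simp add: br_simps)
    qed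
    then show ?thesis using pow[of j] nU by auto
  qed
qed

end

section \<open>Orthonormal bases and the invariant tensor\<close>

locale semisimple_metric_lie_algebra = complex_lie_algebra scale br
  for scale :: "complex \<Rightarrow> 'g::ab_group_add \<Rightarrow> 'g" (infixr "*s" 75)
    and br :: "'g \<Rightarrow> 'g \<Rightarrow> 'g" +
  fixes B :: "'g \<Rightarrow> 'g \<Rightarrow> complex" and S :: "'g set"
  assumes semisimple: semisimple
    and form: "nondegenerate_invariant_form B"
    and basis: "orthonormal_basis B S"
begin

sublocale fd_complex_lie_algebra scale br S
  using basis by unfold_locales (simp_all add: orthonormal_basis_def)

lemma form_simps:
  "B (x + y) z = B x z + B y z" "B (x - y) z = B x z - B y z" "B (- x) z = - B x z"
  "B (c *s x) z = c * B x z" "B 0 z = 0" "B (\<Sum>i\<in>A. h i) z = (\<Sum>i\<in>A. B (h i) z)"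
  "B z (x + y) = B z x + B z y" "B z (x - y) = B z x - B z y" "B z (- x) = - B z x"
  "B z (c *s x) = c * B z x" "B z 0 = 0" "B z (\<Sum>i\<in>A. h i) = (\<Sum>i\<in>A. B z (h i))"
proof -
  have "module_hom scale (*) (\<lambda>x. B x z)" "module_hom scale (*) (B z)" for z
    using form by (simp_all add: nondegenerate_invariant_form_def module_hom_iff_linear)
  note l = this(1)[of z] and r = this(2)[of z]
  show "B (x + y) z = B x z + B y z" "B (x - y) z = B x z - B y z" "B (- x) z = - B x z"
    "B (c *s x) z = c * B x z" "B 0 z = 0" "B (\<Sum>i\<in>A. h i) z = (\<Sum>i\<in>A. B (h i) z)"
    using module_hom.add[OF l] module_hom.diff[OF l] module_hom.neg[OF l] module_hom.scale[OF l]
      module_hom.zero[OF l] module_hom.sum[OF l] by simp_all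
  show "B z (x + y) = B z x + B z y" "B z (x - y) = B z x - B z y" "B z (- x) = - B z x"
    "B z (c *s x) = c * B z x" "B z 0 = 0" "B z (\<Sum>i\<in>A. h i) = (\<Sum>i\<in>A. B z (h i))"
    using module_hom.add[OF r] module_hom.diff[OF r] module_hom.neg[OF r] module_hom.scale[OF r]
      module_hom.zero[OF r] module_hom.sum[OF r] by simp_all
qed

lemma form_sym: "B x y = B y x"
  and form_invariant: "B (br x y) z = B x (br y z)"
  using form unfolding nondegenerate_invariant_form_def by blast+

lemma form_eqI: "(\<And>z. B x z = B y z) \<Longrightarrow> x = y"
  using form form_simps(2)[of x y] unfolding nondegenerate_invariant_form_def
  by (metis eq_iff_diff_eq_0)

lemma S_basis: "finite S" "independent S" "span S = UNIV"
  using basis by (simp_all add: orthonormal_basis_def)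

lemma representation_S: "s \<in> S \<Longrightarrow> representation S v s = B v s"
proof -
  assume s: "s \<in> S"
  have "B v s = (\<Sum>t\<in>S. representation S v t * B t s)"
    by (subst (1) representation_expand[OF S_basis, of v, symmetric]) (simp add: form_simps)
  also have "\<dots> = (\<Sum>t\<in>S. if t = s then representation S v t else 0)"
    using basis s by (intro sum.cong) (auto simp: orthonormal_basis_def)
  finally show ?thesis using s S_basis(1) by simp
qed

lemma orthonormal_expand: "(\<Sum>s\<in>S. B v s *s s) = v"
  using representation_expand[OF S_basis, of v] by (simp add: representation_S cong: sum.cong)

lemma functionalI:
  assumes "\<And>x y. \<phi> (x + y) = \<phi> x + \<phi> y" "\<And>c x. \<phi> (c *s x) = c * \<phi> x"
  shows "Vector_Spaces.linear scale (*) \<phi>"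
proof -
  have "vector_space ((*) :: complex \<Rightarrow> complex \<Rightarrow> complex)"
    by unfold_locales (simp_all add: algebra_simps)
  then show ?thesis using assms vector_space_axioms by (simp add: Vector_Spaces.linear_iff)
qed

definition bilinear_map :: "('g \<Rightarrow> 'g \<Rightarrow> complex) \<Rightarrow> bool" where
  "bilinear_map \<Phi> \<longleftrightarrow> (\<forall>y. Vector_Spaces.linear scale (*) (\<lambda>x. \<Phi> x y)) \<and>
     (\<forall>x. Vector_Spaces.linear scale (*) (\<Phi> x))"

lemma functional_expand:
  assumes "Vector_Spaces.linear scale (*) \<phi>"
  shows "\<phi> v = (\<Sum>s\<in>S. B v s * \<phi> s)"
proof -
  interpret module_hom scale "(*)" \<phi>
    using assms by (simp add: module_hom_iff_linear)
  show ?thesis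
    by (subst (1) orthonormal_expand[of v, symmetric]) (simp add: sum scale)
qed

text \<open>In an orthonormal basis the matrix of \<open>br x\<close> is skew symmetric, by
  invariance of \<open>B\<close>; hence the tensor summing \<open>s\<close> times \<open>s\<close>
  over \<open>S\<close> is invariant. Bilinear maps serve as test functions in place of
  tensors.\<close>

lemma casimir_tensor_invariant:
  assumes "bilinear_map \<Phi>"
  shows "(\<Sum>s\<in>S. \<Phi> (br x s) s) = - (\<Sum>s\<in>S. \<Phi> s (br x s))"
proof -
  have "(\<Sum>s\<in>S. \<Phi> (br x s) s) = (\<Sum>s\<in>S. \<Sum>t\<in>S. B (br x s) t * \<Phi> t s)"
    using assms by (intro sum.cong functional_expand) (auto simp: bilinear_map_def)
  also have "\<dots> = (\<Sum>t\<in>S. \<Sum>s\<in>S. B (br x s) t * \<Phi> t s)"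
    by (rule sum.swap)
  also have "\<dots> = (\<Sum>t\<in>S. \<Sum>s\<in>S. - (B (br x t) s * \<Phi> t s))"
  proof (intro sum.cong refl)
    fix s t
    have "B (br x s) t = - B (br s x) t" using br_skew[of x s] by (simp add: form_simps)
    also have "\<dots> = - B s (br x t)" by (simp only: form_invariant)
    also have "\<dots> = - B (br x t) s" by (simp only: form_sym)
    finally show "B (br x s) t * \<Phi> t s = - (B (br x t) s * \<Phi> t s)" by simp
  qed
  also have "\<dots> = - (\<Sum>t\<in>S. \<Phi> t (br x t))"
  proof -
    have "\<Phi> t (br x t) = (\<Sum>s\<in>S. B (br x t) s * \<Phi> t s)" for t
      using assms by (intro functional_expand) (auto simp: bilinear_map_def)
    then show ?thesis by (simp add: sum_negf)
  qed
  finally show ?thesis .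
qed

section \<open>The Casimir operator and Cartan's criterion\<close>

definition casimir :: "'g \<Rightarrow> 'g" where
  "casimir x = (\<Sum>s\<in>S. br s (br s x))"

lemma endo_casimir: "endo casimir"
  by (intro endoI) (simp_all add: casimir_def br_simps sum.distrib scale_sum_right)

text \<open>Moving \<open>br x\<close> past both copies of \<open>br s\<close> leaves two extra
  sums, which cancel by invariance of the tensor. Pairing with \<open>z\<close> makes the test map
  scalar valued.\<close>

lemma casimir_br: "casimir (br x y) = br x (casimir y)"
proof (rule form_eqI)
  fix z
  have "bilinear_map (\<lambda>a b. B (br a (br b y)) z)"
    by (auto simp: bilinear_map_def br_simps form_simps intro!: functionalI)
  from casimir_tensor_invariant[OF this, of x]
  have 0: "(\<Sum>s\<in>S. B (br (br x s) (br s y)) z) + (\<Sum>s\<in>S. B (br s (br (br x s) y)) z) = 0"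
    by simp
  have "br x (br s (br s y)) = br s (br s (br x y)) + br (br x s) (br s y) + br s (br (br x s) y)" for s
    by (simp add: br_derivation[of x s "br s y"] br_derivation[of x s y] br_simps)
  then have "B (br x (casimir y)) z = B (casimir (br x y)) z
      + ((\<Sum>s\<in>S. B (br (br x s) (br s y)) z) + (\<Sum>s\<in>S. B (br s (br (br x s) y)) z))"
    by (simp add: casimir_def br_simps form_simps sum.distrib)
  then show "B (casimir (br x y)) z = B (br x (casimir y)) z"
    using 0 by simp
qed

text \<open>The right side is the Killing form, so \<open>casimir\<close> is the operator
  representing it with respect to \<open>B\<close>.\<close>

lemma form_casimir: "B (casimir y) z = trace S (\<lambda>v. br z (br y v))"
proof -
  have "B (br s (br s y)) z = representation S (br z (br y s)) s" if "s \<in> S" for s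
  proof -
    have "br (br s y) z = br z (br y s)"
      using br_skew[of "br s y" z] br_skew[of s y] by (simp add: br_simps)
    then have "B (br s (br s y)) z = B s (br z (br y s))"
      by (simp add: form_invariant)
    also have "\<dots> = B (br z (br y s)) s" by (rule form_sym)
    finally show ?thesis using that by (simp add: representation_S)
  qed
  then show ?thesis by (simp add: casimir_def trace_def form_simps)
qed

text \<open>The kernel \<open>R\<close> of the Casimir operator is the radical of the Killing form. Pairing \<open>ad x\<close>,
  \<open>x \<in> [R, R]\<close>, with the derivation \<open>conj_part\<close> gives \<open>\<Sum>|\<lambda>|\<^sup>2 = 0\<close> over the eigenvalues of \<open>ad x\<close>.\<close>

lemma casimir_eq_0_iff: "casimir x = 0 \<longleftrightarrow> x = 0"
proof -
  define R where "R = {y. casimir y = 0}"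
  define D where "D = span {br y z |y z. y \<in> R \<and> z \<in> R}"
  have R: "subspace R"
    by (auto simp: R_def endo_simps[OF endo_casimir] intro!: subspaceI)
  have Rbr: "br x y \<in> R" if "y \<in> R" for x y
    using that by (simp add: R_def casimir_br br_simps)
  \<comment> \<open>Elements of \<open>R\<close> are Killing-orthogonal to everything. The basis is
    left free so that a triangular one can be used.\<close>
  have tr: "trace T (\<lambda>v. br y (br z v)) = 0"
    if "y \<in> R" "finite T" "independent T" "span T = UNIV" for y z T
  proof -
    have "trace T (\<lambda>v. br y (br z v)) = trace S (\<lambda>v. br y (br z v))"
      using trace_basis_independent[OF endo_comp[OF linear_br_right linear_br_right]] that S_basis by blast
    also have "\<dots> = trace S (\<lambda>v. br z (br y v))"
      by (rule trace_commute[OF S_basis linear_br_right linear_br_right])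
    finally show ?thesis
      using that(1) form_simps(5) by (simp add: form_casimir[symmetric] R_def)
  qed
  have Dbr: "br x d \<in> D" if "d \<in> D" for x d
  proof (rule endo_span_subset[OF linear_br_right])
    show "d \<in> span {br y z |y z. y \<in> R \<and> z \<in> R}" using that by (simp add: D_def)
    show "subspace D" by (simp add: D_def)
    fix p assume "p \<in> {br y z |y z. y \<in> R \<and> z \<in> R}"
    then obtain y z where p: "p = br y z" "y \<in> R" "z \<in> R" by blast
    then have "br (br x y) z \<in> D" "br y (br x z) \<in> D"
      using Rbr unfolding D_def by (blast intro: span_base)+
    then show "br x p \<in> D"
      unfolding p br_derivation[of x y z] D_def by (rule span_add)
  qed
  have nil: "\<exists>m. (br x ^^ m) v = 0" if "x \<in> D" for x v
  proof -
    obtain lam ps where T: "triangular (br x) lam ps" "span (set ps) = UNIV"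
      using ex_triangular_basis[OF linear_br_right] by blast
    have B: "finite (set ps)" "independent (set ps)" "span (set ps) = UNIV"
      using triangular_independent[OF T(1)] T(2) by auto
    let ?c = "conj_part lam (set ps)"
    have c: "endo ?c" using endo_conj_part B by blast
    let ?K = "{u. trace (set ps) (\<lambda>v. br u (?c v)) = 0}"
    have "subspace ?K"
      by (intro subspaceI) (simp_all add: trace_def br_simps representation_linear[OF B] sum.distrib
          representation_zero flip: sum_distrib_left)
    moreover have "br y z \<in> ?K" if "y \<in> R" "z \<in> R" for y z
    proof -
      have "trace (set ps) (\<lambda>v. br (br y z) (?c v)) =
          trace (set ps) (\<lambda>v. br y (br z (?c v))) - trace (set ps) (\<lambda>v. br z (br y (?c v)))"
        unfolding br_br_left by (rule trace_diff[OF B])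
      also have "trace (set ps) (\<lambda>v. br z (br y (?c v))) = trace (set ps) (\<lambda>v. br y (?c (br z v)))"
        by (rule trace_commute[OF B linear_br_right endo_comp[OF linear_br_right c]])
      \<comment> \<open>As \<open>?c\<close> is a derivation,
        \<open>br z (?c v) - ?c (br z v)\<close> equals \<open>- br (?c z) v\<close>, so what
        remains is a Killing pairing with \<open>y\<close>.\<close>
      also have "trace (set ps) (\<lambda>v. br y (br z (?c v))) - \<dots> = trace (set ps) (\<lambda>v. br y (br (- ?c z) v))"
        unfolding trace_diff[OF B, symmetric] conj_part_derivation[OF T] by (simp add: br_simps)
      also have "\<dots> = 0"
        using tr that B by blast
      finally show ?thesis by simp
    qed
    ultimately have "D \<subseteq> ?K"
      unfolding D_def by (intro span_minimal) auto
    then show ?thesis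
      using trace_conj_part_eq_0[OF linear_br_right T] \<open>x \<in> D\<close> by blast
  qed
  have D: "subspace D" by (simp add: D_def)
  have abelian: "I = {0}" if "lie_ideal I" "\<And>x y. x \<in> I \<Longrightarrow> y \<in> I \<Longrightarrow> br x y = 0" for I
  proof -
    have "I \<noteq> {}" using that(1) subspace_0 by (auto simp: lie_ideal_def)
    then have "{br x y |x y. x \<in> I \<and> y \<in> I} = {0}" using that(2) by fastforce
    then have "derived_series I (Suc 0) = {0}" by simp
    then show ?thesis
      using semisimple that(1) unfolding semisimple_def solvable_def by blast
  qed
  \<comment> \<open>Otherwise Engel's theorem for \<open>D\<close> acting on itself gives a nonzero
    central element of \<open>D\<close>, while the center \<open>?Z\<close> is an abelian ideal and
    so is zero.\<close>
  have "D = {0}"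
  proof (rule ccontr)
    assume "D \<noteq> {0}"
    then have "{0} \<subset> D" using subspace_0[OF D] by auto
    then have "\<exists>w\<in>D - {0}. \<forall>x\<in>D. br x w \<in> {0}"
      using D Dbr nil by (intro engel) (auto simp: br_simps)
    then obtain w where w: "w \<in> D" "w \<noteq> 0" "\<forall>x\<in>D. br x w = 0" by auto
    let ?Z = "{w \<in> D. \<forall>x\<in>D. br x w = 0}"
    have "br x (br y w) = 0" if "x \<in> D" "w \<in> ?Z" for x y w
      using that Dbr[of x y] br_skew[of x y] by (simp add: br_derivation[of x y w] br_simps)
    then have "lie_ideal ?Z"
      using D Dbr unfolding lie_ideal_def
      by (auto simp: br_simps subspace_0 subspace_add subspace_scale intro!: subspaceI)
    then have "?Z = {0}" by (rule abelian) auto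
    then show False using w by blast
  qed
  then have "br y z = 0" if "y \<in> R" "z \<in> R" for y z
    using that span_base[of "br y z" "{br y z |y z. y \<in> R \<and> z \<in> R}"] unfolding D_def by blast
  moreover have "lie_ideal R"
    using R Rbr by (simp add: lie_ideal_def)
  ultimately have "R = {0}" using abelian by blast
  then show ?thesis by (auto simp: R_def)
qed

text \<open>Injectivity suffices in finite dimension, and the inverse inherits commutation with
  every \<open>br x\<close>.\<close>

lemma ex_casimir_inverse:
  "\<exists>T. endo T \<and> (\<forall>x. casimir (T x) = x) \<and> (\<forall>x y. br x (T y) = T (br x y))"
proof -
  have inj: "inj casimir"
    using casimir_eq_0_iff endo_simps(4)[OF endo_casimir]
    by (metis (no_types, lifting) eq_iff_diff_eq_0 injI)
  then have "surj casimir"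
    by (rule linear_inj_imp_surj[OF endo_casimir])
  then have ci: "casimir (inv casimir x) = x" for x
    by (rule surj_f_inv_f)
  have "endo (inv casimir)"
    by (rule inj_linear_imp_inv_linear[OF endo_casimir inj])
  moreover have "br x (inv casimir y) = inv casimir (br x y)" for x y
    by (rule injD[OF inj]) (simp add: ci casimir_br)
  ultimately show ?thesis using ci by blast
qed

end

section \<open>Alternation over permutations of the arguments\<close>

text \<open>Left unnormalized, to match the inner sums of \<open>wedge\<close>.\<close>

definition alternate :: "('a list \<Rightarrow> complex) \<Rightarrow> 'a list \<Rightarrow> complex" where
  "alternate f vs = (\<Sum>\<sigma> | \<sigma> permutes {..<length vs}.
     of_int (sign \<sigma>) * f (map (\<lambda>i. vs ! \<sigma> i) [0..<length vs]))"

lemma alternate_cong: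
  "(\<And>u. length u = length vs \<Longrightarrow> f u = g u) \<Longrightarrow> alternate f vs = alternate g vs"
  by (simp add: alternate_def)

lemma alternate_zero: "alternate (\<lambda>u. 0) vs = 0"
  by (simp add: alternate_def)

lemma alternate_add: "alternate (\<lambda>u. f u + g u) vs = alternate f vs + alternate g vs"
  by (simp add: alternate_def sum.distrib distrib_left)

lemma alternate_minus: "alternate (\<lambda>u. - f u) vs = - alternate f vs"
  by (simp add: alternate_def sum_negf)

lemma alternate_sum: "alternate (\<lambda>u. \<Sum>i\<in>A. f i u) vs = (\<Sum>i\<in>A. alternate (f i) vs)"
  by (simp add: alternate_def sum_distrib_left) (rule sum.swap)

text \<open>Composing every permutation with one transposition reindexes the sum and flips each
  sign, for arbitrary \<open>f\<close>.\<close>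

lemma alternate_swap:
  assumes ij: "i < length vs" "j < length vs" "i \<noteq> j"
  shows "alternate (\<lambda>u. f (u[i := u ! j, j := u ! i])) vs = - alternate f vs"
proof -
  let ?t = "Transposition.transpose i j" and ?n = "length vs"
  let ?g = "\<lambda>\<sigma>. of_int (sign \<sigma>) * f (map (\<lambda>i. vs ! \<sigma> i) [0..<?n]) :: complex"
  have t: "?t permutes {..<?n}"
    using ij by (intro permutes_swap_id) auto
  have bij: "bij_betw (\<lambda>\<sigma>. \<sigma> \<circ> ?t) {\<sigma>. \<sigma> permutes {..<?n}} {\<sigma>. \<sigma> permutes {..<?n}}"
    by (rule bij_betw_byWitness[where f' = "\<lambda>\<sigma>. \<sigma> \<circ> ?t"])
      (auto simp: o_assoc[symmetric] intro: permutes_compose[OF t])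
  have "alternate f vs = (\<Sum>\<sigma> | \<sigma> permutes {..<?n}. ?g (\<sigma> \<circ> ?t))"
    unfolding alternate_def by (rule sum.reindex_bij_betw[OF bij, symmetric])
  also have "\<dots> = (\<Sum>\<sigma> | \<sigma> permutes {..<?n}. - (of_int (sign \<sigma>) *
      f ((map (\<lambda>i. vs ! \<sigma> i) [0..<?n])[i := vs ! \<sigma> j, j := vs ! \<sigma> i])))"
  proof (rule sum.cong)
    fix \<sigma> assume "\<sigma> \<in> {\<sigma>. \<sigma> permutes {..<?n}}"
    then have "permutation \<sigma>" "permutation ?t"
      using t by (auto intro: permutes_imp_permutation)
    then have "sign (\<sigma> \<circ> ?t) = - sign \<sigma>"
      using ij(3) by (simp add: sign_compose sign_swap_id)
    moreover have "map (\<lambda>i. vs ! (\<sigma> \<circ> ?t) i) [0..<?n] =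
        (map (\<lambda>i. vs ! \<sigma> i) [0..<?n])[i := vs ! \<sigma> j, j := vs ! \<sigma> i]"
      using ij by (intro nth_equalityI) (auto simp: nth_list_update Transposition.transpose_def)
    ultimately show "?g (\<sigma> \<circ> ?t) = - (of_int (sign \<sigma>) *
        f ((map (\<lambda>i. vs ! \<sigma> i) [0..<?n])[i := vs ! \<sigma> j, j := vs ! \<sigma> i]))"
      by simp
  qed simp
  also have "\<dots> = - alternate (\<lambda>u. f (u[i := u ! j, j := u ! i])) vs"
    using ij by (simp add: alternate_def sum_negf)
  finally show ?thesis by simp
qed

text \<open>After alternation, a derivation acting on the slots in \<open>P\<close>, in which \<open>F\<close> is skew, contributes
  as often as it acts on the single slot \<open>s\<close>.\<close>

lemma alternate_derivation:
  assumes P: "P \<subseteq> {..<length vs}" "s \<in> P"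
    and skew: "\<And>u i. length u = length vs \<Longrightarrow> i \<in> P \<Longrightarrow> i \<noteq> s \<Longrightarrow> F (u[i := u ! s, s := u ! i]) = - F u"
  shows "alternate (\<lambda>u. \<Sum>i\<in>P. F (u[i := L (u ! i)])) vs =
    of_nat (card P) * alternate (\<lambda>u. F (u[s := L (u ! s)])) vs"
proof -
  have "alternate (\<lambda>u. F (u[i := L (u ! i)])) vs = alternate (\<lambda>u. F (u[s := L (u ! s)])) vs"
    if i: "i \<in> P" for i
  proof (cases "i = s")
    case False
    let ?g = "\<lambda>u. F (u[i := L (u ! i)])"
    \<comment> \<open>Exchanging slots \<open>i\<close> and \<open>s\<close> carries
      \<open>L\<close> to slot \<open>s\<close>; the sign from skewness of \<open>F\<close> cancels
      the sign from \<open>alternate_swap\<close>.\<close>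
    have "alternate (\<lambda>u. ?g (u[i := u ! s, s := u ! i])) vs = alternate (\<lambda>u. - F (u[s := L (u ! s)])) vs"
    proof (rule alternate_cong)
      fix u :: "'a list" assume u: "length u = length vs"
      let ?w = "u[s := L (u ! s)]"
      have "i < length u" "s < length u" using P i u by auto
      then have "(u[i := u ! s, s := u ! i])[i := L (u[i := u ! s, s := u ! i] ! i)] = ?w[i := ?w ! s, s := ?w ! i]"
        using False by (intro nth_equalityI) (auto simp: nth_list_update)
      then show "?g (u[i := u ! s, s := u ! i]) = - F ?w"
        using skew[of ?w i] u i False by simp
    qed
    moreover have "alternate (\<lambda>u. ?g (u[i := u ! s, s := u ! i])) vs = - alternate ?g vs"
      using P i False by (intro alternate_swap) auto
    ultimately show ?thesis by (simp add: alternate_minus)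
  qed simp
  then show ?thesis by (simp add: alternate_sum)
qed

section \<open>Contractions of invariant forms\<close>

context semisimple_metric_lie_algebra
begin

lemma exterior_slot_linear:
  assumes "\<Omega> \<in> exterior_algebra scale" "i < length vs"
  shows "Vector_Spaces.linear scale (*) (\<lambda>x. \<Omega> (vs[i := x]))"
proof -
  have "component (length vs) \<Omega> \<in> skew_forms scale (length vs)"
    using assms by (simp add: exterior_algebra_def)
  then have "Vector_Spaces.linear scale (*) (\<lambda>x. component (length vs) \<Omega> (vs[i := x]))"
    using assms(2) by (simp add: skew_forms_def)
  then show ?thesis by (simp add: component_def)
qed

lemma exterior_skew:
  assumes "\<Omega> \<in> exterior_algebra scale" "i < length vs" "j < length vs" "i \<noteq> j"
  shows "\<Omega> (vs[i := vs ! j, j := vs ! i]) = - \<Omega> vs"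
proof -
  have "component (length vs) \<Omega> \<in> skew_forms scale (length vs)"
    using assms by (simp add: exterior_algebra_def)
  then have "component (length vs) \<Omega> (vs[i := vs ! j, j := vs ! i]) = - component (length vs) \<Omega> vs"
    using assms(2-) by (simp add: skew_forms_def)
  then show ?thesis by (simp add: component_def)
qed

lemma exterior_simps:
  assumes "\<Omega> \<in> exterior_algebra scale"
  shows "\<Omega> ((x + y) # vs) = \<Omega> (x # vs) + \<Omega> (y # vs)" "\<Omega> ((c *s x) # vs) = c * \<Omega> (x # vs)"
    "\<Omega> ((- x) # vs) = - \<Omega> (x # vs)" "\<Omega> ((\<Sum>i\<in>A. h i) # vs) = (\<Sum>i\<in>A. \<Omega> (h i # vs))"
    "\<Omega> (a # us @ [x + y]) = \<Omega> (a # us @ [x]) + \<Omega> (a # us @ [y])"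
    "\<Omega> (a # us @ [c *s x]) = c * \<Omega> (a # us @ [x])"
    "\<Omega> (a # us @ [- x]) = - \<Omega> (a # us @ [x])"
proof -
  interpret l: module_hom scale "(*)" "\<lambda>x. \<Omega> (x # vs)"
    using exterior_slot_linear[OF assms, of 0 "0 # vs"] by (simp add: module_hom_iff_linear)
  show "\<Omega> ((x + y) # vs) = \<Omega> (x # vs) + \<Omega> (y # vs)" "\<Omega> ((c *s x) # vs) = c * \<Omega> (x # vs)"
    "\<Omega> ((- x) # vs) = - \<Omega> (x # vs)" "\<Omega> ((\<Sum>i\<in>A. h i) # vs) = (\<Sum>i\<in>A. \<Omega> (h i # vs))"
    by (rule l.add l.scale l.neg l.sum)+
  interpret r: module_hom scale "(*)" "\<lambda>x. \<Omega> (a # us @ [x])"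
    using exterior_slot_linear[OF assms, of "Suc (length us)" "a # us @ [0]"]
    by (simp add: module_hom_iff_linear)
  show "\<Omega> (a # us @ [x + y]) = \<Omega> (a # us @ [x]) + \<Omega> (a # us @ [y])"
    "\<Omega> (a # us @ [c *s x]) = c * \<Omega> (a # us @ [x])"
    "\<Omega> (a # us @ [- x]) = - \<Omega> (a # us @ [x])"
    by (rule r.add r.scale r.neg)+
qed

lemma exterior_skew_ends:
  assumes "\<Omega> \<in> exterior_algebra scale"
  shows "\<Omega> (a # us @ [b]) = - \<Omega> (b # us @ [a])"
  using exterior_skew[OF assms, of 0 "b # us @ [a]" "Suc (length us)"] by (simp add: nth_append)

lemma invariant_exterior: "\<Omega> \<in> invariant_forms scale br \<Longrightarrow> \<Omega> \<in> exterior_algebra scale"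
  by (simp add: invariant_forms_def)

lemma invariant_sum:
  assumes "\<Omega> \<in> invariant_forms scale br"
  shows "(\<Sum>i<length vs. \<Omega> (vs[i := br X (vs ! i)])) = 0"
proof -
  have "theta br X \<Omega> vs = 0" using assms by (simp add: invariant_forms_def)
  then show ?thesis by (simp add: theta_def)
qed

text \<open>Up to a factor, the alternation over the last arguments is the differential of the closed
  form \<open>contract X \<Omega>\<close>.\<close>

lemma alternate_invariant_tail:
  assumes \<Omega>: "\<Omega> \<in> invariant_forms scale br" and k: "k < length vs"
  shows "alternate (\<lambda>u. h (take k u) * \<Omega> (br X (u ! k) # drop (Suc k) u)) vs = 0"
proof -
  let ?n = "length vs"
  let ?F = "\<lambda>u. h (take k u) * \<Omega> (drop k u)"
  have "alternate (\<lambda>u. \<Sum>i\<in>{k..<?n}. ?F (u[i := br X (u ! i)])) vs =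
      of_nat (card {k..<?n}) * alternate (\<lambda>u. ?F (u[k := br X (u ! k)])) vs"
  proof (rule alternate_derivation)
    fix u :: "'g list" and i assume u: "length u = ?n" "i \<in> {k..<?n}" "i \<noteq> k"
    then have "drop k (u[i := u ! k, k := u ! i]) =
        (drop k u)[i - k := drop k u ! 0, 0 := drop k u ! (i - k)]"
      by (simp add: drop_update_swap)
    moreover have "i - k < length vs - k" using u k by auto
    ultimately have "\<Omega> (drop k (u[i := u ! k, k := u ! i])) = - \<Omega> (drop k u)"
      using exterior_skew[OF invariant_exterior[OF \<Omega>], of "i - k" "drop k u" 0] u by simp
    then show "?F (u[i := u ! k, k := u ! i]) = - ?F u"
      using u by simp
  qed (use k in auto)
  also have "alternate (\<lambda>u. \<Sum>i\<in>{k..<?n}. ?F (u[i := br X (u ! i)])) vs = alternate (\<lambda>u. 0) vs"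
  proof (rule alternate_cong)
    fix u :: "'g list" assume u: "length u = ?n"
    \<comment> \<open>After shifting the index by \<open>k\<close>, this is the invariance of
      \<open>\<Omega>\<close> on the tail \<open>drop k u\<close>.\<close>
    have "(\<Sum>i\<in>{k..<?n}. ?F (u[i := br X (u ! i)])) =
        (\<Sum>i<length (drop k u). h (take k u) * \<Omega> ((drop k u)[i := br X (drop k u ! i)]))"
      by (rule sum.reindex_bij_witness[where i = "\<lambda>i. i + k" and j = "\<lambda>i. i - k"])
        (use u k in \<open>auto simp: drop_update_swap add.commute\<close>)
    also have "\<dots> = 0"
      using invariant_sum[OF \<Omega>, of "drop k u"] by (simp flip: sum_distrib_left)
    finally show "(\<Sum>i\<in>{k..<?n}. ?F (u[i := br X (u ! i)])) = 0" .
  qed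
  finally have "alternate (\<lambda>u. ?F (u[k := br X (u ! k)])) vs = 0"
    using k by (simp add: alternate_zero)
  moreover have "alternate (\<lambda>u. ?F (u[k := br X (u ! k)])) vs =
      alternate (\<lambda>u. h (take k u) * \<Omega> (br X (u ! k) # drop (Suc k) u)) vs"
  proof (rule alternate_cong)
    fix u :: "'g list" assume "length u = ?n"
    then have "drop k (u[k := br X (u ! k)]) = br X (u ! k) # drop (Suc k) u"
      using k Cons_nth_drop_Suc[of k "u[k := br X (u ! k)]"] by simp
    then show "?F (u[k := br X (u ! k)]) = h (take k u) * \<Omega> (br X (u ! k) # drop (Suc k) u)"
      by simp
  qed
  ultimately show ?thesis by simp
qed

text \<open>This is the formula \<open>d (contract Y (contract Z \<Omega>)) = \<plusminus> contract (br Y Z) \<Omega>\<close>.\<close>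

lemma alternate_invariant_head:
  assumes \<Omega>: "\<Omega> \<in> invariant_forms scale br" and k: "k < length vs"
  shows "alternate (\<lambda>u. \<Omega> (br Y Z # take (Suc k) u) * h (drop (Suc k) u)) vs =
    - (of_nat (Suc k) * alternate (\<lambda>u. \<Omega> (Z # take k u @ [br Y (u ! k)]) * h (drop (Suc k) u)) vs)"
proof -
  let ?n = "length vs"
  let ?F = "\<lambda>u. \<Omega> (Z # take (Suc k) u) * h (drop (Suc k) u)"
  have "alternate (\<lambda>u. \<Sum>i\<in>{..<Suc k}. ?F (u[i := br Y (u ! i)])) vs =
      of_nat (card {..<Suc k}) * alternate (\<lambda>u. ?F (u[k := br Y (u ! k)])) vs"
  proof (rule alternate_derivation)
    fix u :: "'g list" and i assume u: "length u = ?n" "i \<in> {..<Suc k}" "i \<noteq> k"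
    let ?v = "Z # take (Suc k) u"
    have "Z # take (Suc k) (u[i := u ! k, k := u ! i]) =
        ?v[Suc i := ?v ! Suc k, Suc k := ?v ! Suc i]"
      using u k by (simp add: take_update_swap)
    then have "\<Omega> (Z # take (Suc k) (u[i := u ! k, k := u ! i])) = - \<Omega> ?v"
      using exterior_skew[OF invariant_exterior[OF \<Omega>], of "Suc i" ?v "Suc k"] u k by simp
    then show "?F (u[i := u ! k, k := u ! i]) = - ?F u"
      using u by simp
  qed (use k in auto)
  also have "alternate (\<lambda>u. \<Sum>i\<in>{..<Suc k}. ?F (u[i := br Y (u ! i)])) vs =
      alternate (\<lambda>u. - (\<Omega> (br Y Z # take (Suc k) u) * h (drop (Suc k) u))) vs"
  proof (rule alternate_cong)
    fix u :: "'g list" assume u: "length u = ?n"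
    let ?v = "Z # take (Suc k) u"
    have len: "length ?v = Suc (Suc k)" using u k by simp
    \<comment> \<open>Invariance under \<open>Y\<close> on \<open>?v\<close>: slot \<open>0\<close>
      contributes \<open>br Y Z\<close>, and the other slots form the sum to be computed.\<close>
    have "0 = (\<Sum>i<Suc (Suc k). \<Omega> (?v[i := br Y (?v ! i)]))"
      using invariant_sum[OF \<Omega>, of ?v Y] len by simp
    also have "\<dots> = \<Omega> (br Y Z # take (Suc k) u) +
        (\<Sum>i<Suc k. \<Omega> (Z # (take (Suc k) u)[i := br Y (take (Suc k) u ! i)]))"
      by (subst sum.lessThan_Suc_shift) simp
    also have "(\<Sum>i<Suc k. \<Omega> (Z # (take (Suc k) u)[i := br Y (take (Suc k) u ! i)])) =
        (\<Sum>i<Suc k. \<Omega> (Z # take (Suc k) (u[i := br Y (u ! i)])))"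
      by (intro sum.cong) (auto simp: take_update_swap)
    finally have "(\<Sum>i<Suc k. \<Omega> (Z # take (Suc k) (u[i := br Y (u ! i)]))) =
        - \<Omega> (br Y Z # take (Suc k) u)"
      by (simp add: eq_neg_iff_add_eq_0 add.commute)
    moreover have "(\<Sum>i\<in>{..<Suc k}. ?F (u[i := br Y (u ! i)])) =
        (\<Sum>i<Suc k. \<Omega> (Z # take (Suc k) (u[i := br Y (u ! i)]))) * h (drop (Suc k) u)"
      unfolding sum_distrib_right by (intro sum.cong) auto
    ultimately show "(\<Sum>i\<in>{..<Suc k}. ?F (u[i := br Y (u ! i)])) =
        - (\<Omega> (br Y Z # take (Suc k) u) * h (drop (Suc k) u))"
      by simp
  qed
  also have "alternate (\<lambda>u. ?F (u[k := br Y (u ! k)])) vs =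
      alternate (\<lambda>u. \<Omega> (Z # take k u @ [br Y (u ! k)]) * h (drop (Suc k) u)) vs"
    using k by (intro alternate_cong) (simp add: take_Suc_conv_app_nth)
  finally show ?thesis unfolding alternate_minus card_lessThan by (metis minus_minus)
qed

text \<open>Replacing \<open>j\<close> by \<open>casimir (T j)\<close> in the factor
  \<open>I\<close> makes that factor exact under alternation; the invariant tensor then shifts the
  bracket onto \<open>I'\<close>, whose contractions are closed.\<close>

lemma alternate_contractions:
  assumes I: "I \<in> invariant_forms scale br" and I': "I' \<in> invariant_forms scale br"
    and p: "p \<le> length vs"
  shows "alternate (\<lambda>u. \<Sum>j\<in>S. I (j # take p u) * I' (j # drop p u)) vs = 0"
proof -
  obtain T where T: "endo T" "\<And>x. casimir (T x) = x" "\<And>x y. br x (T y) = T (br x y)"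
    using ex_casimir_inverse by blast
  note s = exterior_simps[OF invariant_exterior[OF I]] and s' = exterior_simps[OF invariant_exterior[OF I']]
  show ?thesis
  proof (cases p)
    case 0
    \<comment> \<open>An invariant linear form kills brackets, hence the range of
      \<open>casimir\<close>, which is everything.\<close>
    have "I [br x y] = 0" for x y
      using invariant_sum[OF I, of "[y]" x] by simp
    then have "I [casimir x] = 0" for x
      unfolding casimir_def s by simp
    then have "I [x] = 0" for x
      using T(2)[of x] by metis
    then show ?thesis by (simp add: 0 alternate_zero)
  next
    case (Suc k)
    let ?H = "\<lambda>us w. \<Sum>s\<in>S. I (s # us @ [br s w])"
    let ?h = "\<lambda>j us. I' (j # us)"
    \<comment> \<open>The bracket with \<open>x\<close> passes from the last slot of
      \<open>I\<close> to the first slot of \<open>I'\<close>.\<close>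
    have tensor: "(\<Sum>j\<in>S. \<Sum>s\<in>S. I (br s (T j) # us @ [br s x]) * I' (j # ws)
        - I (s # us @ [br (br s (T j)) x]) * I' (j # ws)) = (\<Sum>j\<in>S. ?H us (T j) * I' (br j x # ws))"
      for x us ws
    proof -
      \<comment> \<open>Invariance of the tensor over \<open>s\<close> absorbs \<open>x\<close> into
        \<open>w\<close>.\<close>
      have H: "(\<Sum>s\<in>S. I (br s w # us @ [br s x]) - I (s # us @ [br (br s w) x])) = ?H us (br x w)" for w
      proof -
        have "bilinear_map (\<lambda>a b. I (a # us @ [br b w]))"
          by (auto simp: bilinear_map_def s br_simps intro!: functionalI)
        from casimir_tensor_invariant[OF this, of x]
        have 0: "(\<Sum>s\<in>S. I (br x s # us @ [br s w]) + I (s # us @ [br (br x s) w])) = 0"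
          by (simp add: sum.distrib)
        have "I (br s w # us @ [br s x]) - I (s # us @ [br (br s w) x]) =
            (I (br x s # us @ [br s w]) + I (s # us @ [br (br x s) w])) + I (s # us @ [br s (br x w)])" for s
        proof -
          have "I (br s w # us @ [br s x]) = I (br x s # us @ [br s w])"
            using exterior_skew_ends[OF invariant_exterior[OF I], of "br s w" us "br s x"] br_skew[of s x]
            by (simp add: s)
          moreover have "- I (s # us @ [br (br s w) x]) = I (s # us @ [br x (br s w)])"
            using br_skew[of "br s w" x] by (simp add: s)
          ultimately show ?thesis
            by (simp add: br_derivation[of x s w] s)
        qed
        then show ?thesis using 0 by (simp add: sum.distrib)
      qed
      \<comment> \<open>Since \<open>T\<close> commutes with \<open>br x\<close>, the tensor over
        \<open>j\<close> now moves \<open>x\<close> over to \<open>I'\<close>.\<close>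
      have "bilinear_map (\<lambda>a b. ?H us (T a) * I' (b # ws))"
        by (auto simp: bilinear_map_def s s' br_simps endo_simps[OF T(1)] sum.distrib ring_distribs
            sum_distrib_left ac_simps intro!: functionalI)
      from casimir_tensor_invariant[OF this, of x]
      have "(\<Sum>j\<in>S. ?H us (br x (T j)) * I' (j # ws)) = - (\<Sum>j\<in>S. ?H us (T j) * I' (br x j # ws))"
        by (simp only: T(3))
      also have "\<dots> = (\<Sum>j\<in>S. ?H us (T j) * I' (br j x # ws))"
      proof -
        have "I' (br x j # ws) = - I' (br j x # ws)" for j
          using br_skew[of x j] by (simp add: s')
        then show ?thesis by (simp add: sum_negf)
      qed
      finally show ?thesis
        unfolding H[symmetric] by (simp add: sum_distrib_right left_diff_distrib)
    qed
    have k: "k < length vs" using p Suc by simp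
    \<comment> \<open>Up to sign, \<open>br s (br s (T j))\<close> is a bracket
      \<open>br Y Z\<close> in two ways, with \<open>s\<close> as \<open>Y\<close> or as
      \<open>Z\<close>. Using both gives the difference in \<open>tensor\<close> and the factor
      2.\<close>
    let ?A = "\<lambda>j s. alternate (\<lambda>u. I (br s (br s (T j)) # take (Suc k) u) * ?h j (drop (Suc k) u)) vs"
    have A1: "?A j s = - (of_nat (Suc k) *
        alternate (\<lambda>u. I (br s (T j) # take k u @ [br s (u ! k)]) * ?h j (drop (Suc k) u)) vs)" for j s
      by (rule alternate_invariant_head[OF I k])
    have A2: "- ?A j s = - (of_nat (Suc k) *
        alternate (\<lambda>u. I (s # take k u @ [br (br s (T j)) (u ! k)]) * ?h j (drop (Suc k) u)) vs)" for j s
    proof -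
      have "- ?A j s = alternate (\<lambda>u. I (br (br s (T j)) s # take (Suc k) u) * ?h j (drop (Suc k) u)) vs"
        unfolding alternate_minus[symmetric] using br_skew[of s "br s (T j)"]
        by (intro alternate_cong) (simp add: s)
      then show ?thesis using alternate_invariant_head[OF I k, of "br s (T j)" s "?h j"] by simp
    qed
    have "- 2 * (\<Sum>j\<in>S. \<Sum>s\<in>S. ?A j s) = of_nat (Suc k) * alternate (\<lambda>u. \<Sum>j\<in>S. \<Sum>s\<in>S.
        I (br s (T j) # take k u @ [br s (u ! k)]) * I' (j # drop (Suc k) u)
        - I (s # take k u @ [br (br s (T j)) (u ! k)]) * I' (j # drop (Suc k) u)) vs"
    proof -
      have "- 2 * ?A j s = of_nat (Suc k) * alternate (\<lambda>u.
        I (br s (T j) # take k u @ [br s (u ! k)]) * I' (j # drop (Suc k) u)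
        - I (s # take k u @ [br (br s (T j)) (u ! k)]) * I' (j # drop (Suc k) u)) vs" for j s
        unfolding diff_conv_add_uminus alternate_add alternate_minus
        using A1[of s j] A2[of s j] by (simp only: distrib_left) algebra
      then show ?thesis
        by (simp only: alternate_sum sum_distrib_left)
    qed
    also have "alternate (\<lambda>u. \<Sum>j\<in>S. \<Sum>s\<in>S.
        I (br s (T j) # take k u @ [br s (u ! k)]) * I' (j # drop (Suc k) u)
        - I (s # take k u @ [br (br s (T j)) (u ! k)]) * I' (j # drop (Suc k) u)) vs = 0"
      unfolding tensor alternate_sum
      by (intro sum.neutral ballI alternate_invariant_tail[OF I' k])
    finally have "(\<Sum>j\<in>S. \<Sum>s\<in>S. ?A j s) = 0" by simp
    also have "(\<Sum>j\<in>S. \<Sum>s\<in>S. ?A j s) =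
        alternate (\<lambda>u. \<Sum>j\<in>S. I (casimir (T j) # take (Suc k) u) * I' (j # drop (Suc k) u)) vs"
      unfolding alternate_sum[symmetric] casimir_def s sum_distrib_right ..
    finally show ?thesis by (simp add: Suc T(2))
  qed
qed

text \<open>Contraction lowers the degree by one, so only \<open>p\<close> with
  \<open>w = Suc p\<close> contributes; there the inner sums over permutations already cancel,
  before division by the factorials.\<close>

lemma wedge_contractions:
  assumes I: "I \<in> invariant_forms scale br" and I': "I' \<in> invariant_forms scale br"
  shows "(\<Sum>X\<in>S. wedge (contract X (component w I)) (contract X I') vs) = 0"
proof -
  let ?n = "length vs"
  let ?a = "\<lambda>X p. \<Sum>\<sigma> | \<sigma> permutes {..<?n}. of_int (sign \<sigma>)
      * contract X (component w I) (map (\<lambda>i. vs ! \<sigma> i) [0..<p])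
      * contract X I' (map (\<lambda>i. vs ! \<sigma> i) [p..<?n])"
  have "(\<Sum>X\<in>S. ?a X p) = 0" if p: "p \<le> ?n" for p
  proof (cases "w = Suc p")
    case True
    have "(\<Sum>X\<in>S. ?a X p) = (\<Sum>X\<in>S. alternate (\<lambda>u. I (X # take p u) * I' (X # drop p u)) vs)"
      using p by (simp add: True alternate_def contract_def component_def take_map drop_map
          min_absorb1 mult.assoc)
    then show ?thesis
      using alternate_contractions[OF I I' p] by (simp add: alternate_sum)
  qed (simp add: contract_def component_def)
  then have "(\<Sum>p\<le>?n. (\<Sum>X\<in>S. ?a X p) / (fact p * fact (?n - p))) = 0"
    by simp
  then show ?thesis
    unfolding wedge_def by (subst sum.swap) (simp flip: sum_divide_distrib)
qed

end

theorem proposition8p2p1: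
  fixes scale :: "complex \<Rightarrow> 'g::ab_group_add \<Rightarrow> 'g"
    and br :: "'g \<Rightarrow> 'g \<Rightarrow> 'g"
    and B :: "'g \<Rightarrow> 'g \<Rightarrow> complex"
    and E S :: "'g set"
    and I I' :: "'g form"
  assumes "complex_lie_algebra scale br"
    and "finite_dimensional_vector_space scale E"
    and "complex_lie_algebra.semisimple scale br"
    and "complex_lie_algebra.nondegenerate_invariant_form scale br B"
    and "complex_lie_algebra.orthonormal_basis scale B S"
    and "I \<in> invariant_forms scale br"
    and "I' \<in> invariant_forms scale br"
  shows "super_poisson S I I' = (\<lambda>_. 0)"
proof -
  interpret complex_lie_algebra scale br by fact
  interpret semisimple_metric_lie_algebra scale br B S
    using assms(3-5) by unfold_locales
  show ?thesis
    using wedge_contractions[OF assms(6,7)]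
    by (simp add: super_poisson_def poisson_homogeneous_def)
qed

end
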